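(* Let $C_4$ be the $4$-cycle. There are constants $c,C>0$ such that for all sufficiently large $n$, $$c\,n^{3/2}<b_{C_4}(n)<n^{C\sqrt{\log n}}.$$
   Context: For a graph $G$, $\mathrm{cl}(G)$ denotes its clique complex. For a finite simple graph $H$ and a fixed field $\mathbb{K}$, $b_H(n)=\max_G \sum_{i\ge -1}\dim_{\mathbb{K}}\widetilde H_i(\mathrm{cl}(G);\mathbb{K})$, where $G$ ranges over all simple graphs on at most $n$ vertices containing no induced copy of $H$ (reduced homology, the empty graph contributing $1$). *)

theory Defs
  imports "HOL-Analysis.Analysis" "HOL-Library.Function_Algebras"
begin

definition simple_graph_on :: "nat set \<Rightarrow> (nat \<Rightarrow> nat \<Rightarrow> bool) \<Rightarrow> bool" where
  "simple_graph_on V E \<longleftrightarrow> (\<forall>x y. E x y \<longrightarrow> x \<in> V \<and> y \<in> V \<and> x \<noteq> y \<and> E y x)"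

definition induced_C4_free :: "nat set \<Rightarrow> (nat \<Rightarrow> nat \<Rightarrow> bool) \<Rightarrow> bool" where
  "induced_C4_free V E \<longleftrightarrow> \<not> (\<exists>a\<in>V. \<exists>b\<in>V. \<exists>c\<in>V. \<exists>d\<in>V.
      distinct [a, b, c, d] \<and> E a b \<and> E b c \<and> E c d \<and> E d a \<and> \<not> E a c \<and> \<not> E b d)"

text \<open>Faces of the clique complex with j vertices (dimension j-1); the empty face is the
  unique face with 0 vertices (augmented complex, giving reduced homology).\<close>
definition cliques :: "nat set \<Rightarrow> (nat \<Rightarrow> nat \<Rightarrow> bool) \<Rightarrow> nat \<Rightarrow> nat set set" where
  "cliques V E j = {\<sigma>. \<sigma> \<subseteq> V \<and> card \<sigma> = j \<and> (\<forall>x\<in>\<sigma>. \<forall>y\<in>\<sigma>. x \<noteq> y \<longrightarrow> E x y)}"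

definition chains :: "nat set \<Rightarrow> (nat \<Rightarrow> nat \<Rightarrow> bool) \<Rightarrow> nat \<Rightarrow> (nat set \<Rightarrow> 'k::field) set" where
  "chains V E j = {f. \<forall>\<sigma>. \<sigma> \<notin> cliques V E j \<longrightarrow> f \<sigma> = 0}"

text \<open>Boundary map from chains on j-vertex faces to chains on (j-1)-vertex faces, with the
  orientation induced by the order on nat: the face [v_0<...<v_i] maps to
  sum_k (-1)^k [v_0..(omit v_k)..v_i]. The map from the empty face (j = 0) is zero.\<close>
definition bd :: "nat set \<Rightarrow> (nat \<Rightarrow> nat \<Rightarrow> bool) \<Rightarrow> nat \<Rightarrow> (nat set \<Rightarrow> 'k::field) \<Rightarrow> (nat set \<Rightarrow> 'k)" where
  "bd V E j f = (\<lambda>\<tau>. if j = 0 then 0 else if \<tau> \<in> cliques V E (j - 1) then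
      (\<Sum>v\<in>{v\<in>V - \<tau>. insert v \<tau> \<in> cliques V E j}. (-1) ^ card {u\<in>\<tau>. u < v} * f (insert v \<tau>))
    else 0)"

definition fdim :: "(nat set \<Rightarrow> 'k::field) set \<Rightarrow> nat" where
  "fdim S = vector_space.dim (\<lambda>c f x. c * f x) S"

text \<open>dim of reduced homology H~_(j-1)(cl(G); 'k) = dim ker bd_j - dim im bd_(j+1).\<close>
definition red_betti :: "'k::field itself \<Rightarrow> nat set \<Rightarrow> (nat \<Rightarrow> nat \<Rightarrow> bool) \<Rightarrow> nat \<Rightarrow> nat" where
  "red_betti K V E j =
     fdim {f \<in> (chains V E j :: (nat set \<Rightarrow> 'k) set). bd V E j f = 0}
     - fdim (bd V E (Suc j) ` (chains V E (Suc j) :: (nat set \<Rightarrow> 'k) set))"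

text \<open>Total reduced Betti number: sum over i >= -1 (i = j - 1); faces have at most card V
  vertices, so all terms with j > card V + 1 vanish.\<close>
definition total_red_betti :: "'k::field itself \<Rightarrow> nat set \<Rightarrow> (nat \<Rightarrow> nat \<Rightarrow> bool) \<Rightarrow> nat" where
  "total_red_betti K V E = (\<Sum>j\<in>{0..card V + 1}. red_betti K V E j)"

text \<open>b_{C4}(n): maximum over induced-C4-free simple graphs on at most n vertices
  (every such graph is isomorphic to one on vertex set {0..<m}, m \<le> n).\<close>
definition b_C4 :: "'k::field itself \<Rightarrow> nat \<Rightarrow> nat" where
  "b_C4 K n = Max {total_red_betti K {0..<m} E | m E.
      m \<le> n \<and> simple_graph_on {0..<m} E \<and> induced_C4_free {0..<m} E}"

end

theory Submission
  imports "HOL-Algebra.Algebraic_Closure_Type" "HOL-Library.Z2" Defs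
begin

text \<open>
  For the upper bound, let \<open>\<beta>\<close> denote reduced Betti numbers of clique complexes. If \<open>Q\<close> is a
  nonempty clique of a graph \<open>W\<close> without induced \<open>C\<^sub>4\<close>, then the neighbourhoods in \<open>Q\<close> of two
  adjacent vertices outside \<open>Q\<close> are nested, so the closed neighbourhood of \<open>Q\<close> is acyclic and
  Mayer--Vietoris gives \<open>\<beta>\<^sub>i(W) \<le> \<beta>\<^sub>i(W - Q) + \<beta>\<^bsub>i-1\<^esub>(N(Q))\<close>. Two nonadjacent vertices
  have a clique as common neighbourhood; from this, homology in degree \<open>i\<close> forces at least
  \<open>(3/2)\<^sup>i\<close> vertices, so only \<open>O(log n)\<close> degrees matter, and (following Gyarfas, Hubenko and
  Solymosi) minimum degree \<open>n/k\<close> forces a clique of size \<open>n/(4k\<^sup>2)\<close>. Peeling off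
  vertices of degree below \<open>n/k\<close> and otherwise cliques of size at least \<open>n/(4k\<^sup>3)\<close> bounds the
  maximum \<open>P(i,n)\<close> of \<open>\<beta>\<^sub>i\<close> by \<open>n P(i-1, n/k) + 4k\<^sup>3 P(i-1, n)\<close>. Since \<open>i = O(log n)\<close>, the
  choice \<open>k = exp (sqrt (ln n))\<close> yields \<open>n\<close> to the power \<open>O(sqrt (ln n))\<close>.

  For the lower bound, the incidence graph of the affine plane over the field with \<open>q = 2\<^sup>k\<close>
  elements (with the vertical lines omitted) has \<open>2q\<^sup>2\<close> vertices, \<open>q\<^sup>3\<close> edges, no triangle and no
  4-cycle, so that its first Betti number is at least \<open>q\<^sup>3 - 2q\<^sup>2\<close>.
\<close>

section \<open>Linear algebra and chain complexes\<close>

context vector_space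
begin

text \<open>A basis of \<open>A\<close> together with \<open>F\<close> spans \<open>Z\<close>. The
  finite set \<open>G\<close> makes that basis finite; an infinite one would count as 0 under
  \<open>card\<close>.\<close>

lemma dim_le_dim_plus_card:
  assumes fin: "finite G" "A \<subseteq> span G" and F: "finite F" and Z: "Z \<subseteq> span (A \<union> F)"
  shows "dim Z \<le> dim A + card F"
proof -
  obtain B where B: "B \<subseteq> A" "independent B" "A \<subseteq> span B" "card B = dim A"
    by (rule basis_exists)
  have "finite B"
    using B(1,2) fin independent_span_bound[of G B] by auto
  have "A \<union> F \<subseteq> span (B \<union> F)"
    using B(3) span_mono[of B "B \<union> F"] span_superset[of "B \<union> F"] by auto
  then have "Z \<subseteq> span (B \<union> F)"
    using Z span_minimal[OF _ subspace_span] by blast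
  then have "dim Z \<le> card (B \<union> F)"
    using \<open>finite B\<close> F by (intro dim_le_card) auto
  also have "\<dots> \<le> dim A + card F"
    using card_Un_le[of B F] B(4) by simp
  finally show ?thesis .
qed

text \<open>A basis \<open>B\<close> of \<open>A\<close> is extended by elements of \<open>Z\<close>
  to \<open>M\<close>, and independence forces \<open>card M \<le> card (B \<union> F)\<close>. This
  serves to choose generators inside the image of a linear map, where they have preimages.\<close>

lemma spanning_modulo_subset:
  assumes fin: "finite G" "A \<subseteq> span G" and F: "finite F" and Z: "Z \<subseteq> span (A \<union> F)"
  obtains F' where "F' \<subseteq> Z" "finite F'" "card F' \<le> card F" "Z \<subseteq> span (A \<union> F')"
proof -
  obtain B where B: "B \<subseteq> A" "independent B" "A \<subseteq> span B" "card B = dim A"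
    by (rule basis_exists)
  have finB: "finite B"
    using B(1,2) fin independent_span_bound[of G B] by auto
  obtain M where M: "B \<subseteq> M" "M \<subseteq> B \<union> Z" "independent M" "B \<union> Z \<subseteq> span M"
    using maximal_independent_subset_extend[of B "B \<union> Z"] B(2) by blast
  have "A \<union> F \<subseteq> span (B \<union> F)"
    using B(3) span_mono[of B "B \<union> F"] span_superset[of "B \<union> F"] by auto
  then have "Z \<subseteq> span (B \<union> F)"
    using Z span_minimal[OF _ subspace_span] by blast
  then have "M \<subseteq> span (B \<union> F)"
    using M(2) span_superset[of "B \<union> F"] by blast
  then have fM: "finite M" "card M \<le> card (B \<union> F)"
    using independent_span_bound[of "B \<union> F" M] M(3) finB F by auto
  show thesis
  proof
    show "M - B \<subseteq> Z" "finite (M - B)" using M fM by auto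
    show "card (M - B) \<le> card F"
      using fM card_Un_le[of B F] M(1) finB by (simp add: card_Diff_subset)
    have "M \<subseteq> A \<union> (M - B)" using B(1) by auto
    then show "Z \<subseteq> span (A \<union> (M - B))" using M(4) span_mono[of M] by blast
  qed
qed

text \<open>With cycles for \<open>Z\<close> and boundaries for \<open>A\<close>, this produces
  cycles that generate homology, at most as many as the Betti number.\<close>

lemma spanning_modulo_dim_diff:
  assumes fin: "finite G" "Z \<subseteq> span G" and AZ: "A \<subseteq> Z"
  obtains F where "F \<subseteq> Z" "finite F" "card F \<le> dim Z - dim A" "Z \<subseteq> span (A \<union> F)"
proof -
  obtain B where B: "B \<subseteq> A" "independent B" "A \<subseteq> span B" "card B = dim A"
    by (rule basis_exists)
  obtain M where M: "B \<subseteq> M" "M \<subseteq> Z" "independent M" "Z \<subseteq> span M"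
    using maximal_independent_subset_extend[of B Z] B(1,2) AZ by blast
  have cM: "card M = dim Z" using M by (intro basis_card_eq_dim) auto
  have fM: "finite M" using M fin independent_span_bound[of G M] by auto
  show thesis
  proof
    show "M - B \<subseteq> Z" "finite (M - B)" using M fM by auto
    show "card (M - B) \<le> dim Z - dim A"
      using fM M(1) cM B(4) finite_subset[OF M(1)] by (simp add: card_Diff_subset)
    have "M \<subseteq> A \<union> (M - B)" using B(1) by auto
    then show "Z \<subseteq> span (A \<union> (M - B))" using M(4) span_mono[of M] by blast
  qed
qed

end

interpretation fs: vector_space "\<lambda>(c::'k::field) (f::nat set \<Rightarrow> 'k) x. c * f x"
  by unfold_locales (auto simp: fun_eq_iff algebra_simps)

lemma fdim_eq_dim: "fdim S = fs.dim S"
  by (simp add: fdim_def)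

section \<open>The boundary operator\<close>

definition face_sign :: "nat \<Rightarrow> nat set \<Rightarrow> 'k::field" where
  "face_sign v \<tau> = (-1) ^ card {u\<in>\<tau>. u < v}"

lemma face_sign_square [simp]: "face_sign v \<tau> * face_sign v \<tau> = (1::'k::field)"
  unfolding face_sign_def by (metis left_minus_one_mult_self mult.right_neutral)

lemma face_sign_insert:
  assumes "finite \<tau>" "w \<notin> \<tau>"
  shows "face_sign v (insert w \<tau>) = (if w < v then - face_sign v \<tau> else face_sign v \<tau> :: 'k::field)"
proof -
  have "{u \<in> insert w \<tau>. u < v} = (if w < v then insert w {u\<in>\<tau>. u < v} else {u\<in>\<tau>. u < v})"
    by auto
  then show ?thesis using assms by (simp add: face_sign_def)
qed

text \<open>The two orders of removing \<open>v\<close> and \<open>w\<close> from a face carry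
  opposite signs. This is the cancellation behind the vanishing of the squared boundary.\<close>

lemma face_sign_swap:
  assumes "finite \<tau>" "v \<notin> \<tau>" "w \<notin> \<tau>" "v \<noteq> w"
  shows "face_sign v \<tau> * face_sign w (insert v \<tau>)
       = - (face_sign w \<tau> * face_sign v (insert w \<tau>) :: 'k::field)"
  using assms by (auto simp: face_sign_insert)

text \<open>The graph enters only through the support of \<open>f\<close>. Hence a single operator
  acts on the chains of all subsets of \<open>U\<close>; \<open>bd_Suc_eq_bnd\<close> relates it to
  \<open>bd\<close>.\<close>

definition bnd :: "nat set \<Rightarrow> (nat set \<Rightarrow> 'k::field) \<Rightarrow> nat set \<Rightarrow> 'k" where
  "bnd U f \<tau> = (\<Sum>v\<in>U - \<tau>. face_sign v \<tau> * f (insert v \<tau>))"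

lemma bnd_0 [simp]: "bnd U 0 = 0"
  by (simp add: bnd_def fun_eq_iff)

lemma bnd_add: "bnd U (f + g) = bnd U f + bnd U g"
  by (simp add: bnd_def fun_eq_iff algebra_simps sum.distrib)

lemma bnd_diff: "bnd U (f - g) = bnd U f - bnd U g"
  by (simp add: bnd_def fun_eq_iff algebra_simps sum_subtractf)

lemma bnd_scale: "bnd U (\<lambda>x. c * f x) = (\<lambda>x. c * bnd U f x)"
  by (simp add: bnd_def fun_eq_iff sum_distrib_left algebra_simps)

text \<open>The terms are indexed by ordered pairs of distinct vertices outside
  \<open>\<tau>\<close>; those with \<open>v < w\<close> (the set \<open>P\<close>) cancel against
  their swaps.\<close>

lemma bnd_bnd:
  assumes "finite U" "finite \<tau>"
  shows "bnd U (bnd U f) \<tau> = (0 :: 'k::field)"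
proof -
  define g where "g v w = face_sign v \<tau> * face_sign w (insert v \<tau>) * f (insert w (insert v \<tau>))" for v w
  define P where "P = {(v,w). v \<in> U - \<tau> \<and> w \<in> U - \<tau> \<and> v < w}"
  have "P \<subseteq> U \<times> U" by (auto simp: P_def)
  then have fP: "finite P" using assms finite_subset by blast
  have anti: "g w v = - g v w" if "(v,w) \<in> P" for v w
  proof -
    have "face_sign w \<tau> * face_sign v (insert w \<tau>) = - (face_sign v \<tau> * face_sign w (insert v \<tau>) :: 'k)"
      using that assms by (intro face_sign_swap) (auto simp: P_def)
    then show ?thesis by (simp add: g_def insert_commute)
  qed
  have "bnd U (bnd U f) \<tau> = (\<Sum>v\<in>U - \<tau>. \<Sum>w\<in>U - insert v \<tau>. g v w)"
    by (simp add: bnd_def g_def sum_distrib_left mult.assoc)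
  also have "\<dots> = (\<Sum>(v,w)\<in>(SIGMA v:U - \<tau>. U - insert v \<tau>). g v w)"
    using assms by (intro sum.Sigma) auto
  also have "(SIGMA v:U - \<tau>. U - insert v \<tau>) = P \<union> prod.swap ` P"
    by (auto simp: P_def image_iff)
  also have "(\<Sum>(v,w)\<in>P \<union> prod.swap ` P. g v w) = (\<Sum>(v,w)\<in>P. g v w) + (\<Sum>(v,w)\<in>prod.swap ` P. g v w)"
    using fP by (intro sum.union_disjoint) (auto simp: P_def)
  also have "(\<Sum>(v,w)\<in>prod.swap ` P. g v w) = (\<Sum>(v,w)\<in>P. g w v)"
    by (subst sum.reindex) (auto simp: case_prod_unfold)
  also have "\<dots> = (\<Sum>(v,w)\<in>P. - g v w)"
    by (rule sum.cong) (auto simp: anti)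
  also have "(\<Sum>(v,w)\<in>P. g v w) + \<dots> = 0"
    by (simp add: case_prod_unfold sum_negf)
  finally show ?thesis .
qed

lemma cliques_finite: "finite W \<Longrightarrow> finite (cliques W E j)"
  by (rule finite_subset[of _ "Pow W"]) (auto simp: cliques_def)

lemma cliques_mono: "A \<subseteq> W \<Longrightarrow> cliques A E j \<subseteq> cliques W E j"
  by (auto simp: cliques_def)

lemma chains_mono: "A \<subseteq> W \<Longrightarrow> chains A E j \<subseteq> chains W E j"
  using cliques_mono[of A W E j] by (auto simp: chains_def)

lemma cliques_Int: "cliques (A \<inter> B) E j = cliques A E j \<inter> cliques B E j"
  by (auto simp: cliques_def)

lemma chains_Int: "chains (A \<inter> B) E j = chains A E j \<inter> chains B E j"
  by (auto simp: chains_def cliques_Int)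

lemma chains_subspace: "fs.subspace (chains W E j :: (nat set \<Rightarrow> 'k::field) set)"
  by (auto simp: fs.subspace_def chains_def)

lemma clique_insertD:
  assumes "insert v \<tau> \<in> cliques W E (Suc j)" "v \<notin> \<tau>"
  shows "v \<in> W" "\<tau> \<in> cliques W E j"
proof -
  have "finite (insert v \<tau>)" using assms(1) by (intro card_ge_0_finite) (simp add: cliques_def)
  then show "v \<in> W" "\<tau> \<in> cliques W E j" using assms by (auto simp: cliques_def)
qed

lemma bnd_chains:
  assumes "f \<in> chains W E (Suc j)"
  shows "bnd U f \<in> (chains W E j :: (nat set \<Rightarrow> 'k::field) set)"
proof -
  have "bnd U f \<tau> = 0" if "\<tau> \<notin> cliques W E j" for \<tau>
    unfolding bnd_def
  proof (rule sum.neutral, safe)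
    fix v assume "v \<in> U" "v \<notin> \<tau>"
    then have "insert v \<tau> \<notin> cliques W E (Suc j)" using that clique_insertD by blast
    then show "face_sign v \<tau> * f (insert v \<tau>) = 0" using assms by (auto simp: chains_def)
  qed
  then show ?thesis by (auto simp: chains_def)
qed

lemma bd_Suc_eq_bnd:
  fixes f :: "nat set \<Rightarrow> 'k::field"
  assumes U: "finite U" "W \<subseteq> U" and f: "f \<in> chains W E (Suc j)"
  shows "bd W E (Suc j) f = bnd U f"
proof
  fix \<tau>
  show "bd W E (Suc j) f \<tau> = bnd U f \<tau>"
  proof (cases "\<tau> \<in> cliques W E j")
    case True
    have "(\<Sum>v\<in>{v\<in>W - \<tau>. insert v \<tau> \<in> cliques W E (Suc j)}. face_sign v \<tau> * f (insert v \<tau>)) = bnd U f \<tau>"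
      unfolding bnd_def using U f by (intro sum.mono_neutral_left) (auto simp: chains_def dest: clique_insertD(1))
    then show ?thesis using True by (simp add: bd_def face_sign_def)
  next
    case False
    then show ?thesis using bnd_chains[OF f, of U] by (auto simp: bd_def chains_def)
  qed
qed

section \<open>Cycles, boundaries and generators of homology\<close>

definition cycles :: "nat set \<Rightarrow> (nat \<Rightarrow> nat \<Rightarrow> bool) \<Rightarrow> nat \<Rightarrow> (nat set \<Rightarrow> 'k::field) set" where
  "cycles W E j = {f \<in> chains W E j. bnd W f = 0}"

definition boundaries :: "nat set \<Rightarrow> (nat \<Rightarrow> nat \<Rightarrow> bool) \<Rightarrow> nat \<Rightarrow> (nat set \<Rightarrow> 'k::field) set" where
  "boundaries W E j = bnd W ` chains W E (Suc j)"

text \<open>\<open>insert v \<tau>\<close> is never the empty face. So \<open>cycles\<close> is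
  correct for \<open>j = 0\<close> as well, without the case distinction made in
  \<open>bd\<close>.\<close>

lemma bnd_chains_0:
  assumes "f \<in> chains W E 0" "finite W"
  shows "bnd U f = 0"
proof
  fix \<tau>
  have "insert v \<tau> \<notin> cliques W E 0" for v
    using assms(2) by (auto simp: cliques_def dest: finite_subset)
  then show "bnd U f \<tau> = 0 \<tau>" using assms(1) by (simp add: bnd_def chains_def)
qed

lemma bnd_ambient:
  assumes "finite U" "W \<subseteq> U" "f \<in> chains W E j"
  shows "bnd U f = bnd W f"
proof (cases j)
  case 0
  have "bnd Y f = 0" for Y
    using bnd_chains_0 assms finite_subset 0 by blast
  then show ?thesis by simp
next
  case (Suc i)
  then show ?thesis using assms bd_Suc_eq_bnd[of U W f E i] bd_Suc_eq_bnd[of W W f E i]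
    by (auto intro: finite_subset)
qed

lemma cycles_subspace: "fs.subspace (cycles W E j :: (nat set \<Rightarrow> 'k::field) set)"
  using chains_subspace[where ?'k='k, of W E j]
  by (auto simp: fs.subspace_def cycles_def bnd_add bnd_scale simp del: plus_fun_apply)

lemma boundaries_subset_cycles:
  assumes "finite W"
  shows "boundaries W E j \<subseteq> (cycles W E j :: (nat set \<Rightarrow> 'k::field) set)"
proof
  fix g :: "nat set \<Rightarrow> 'k" assume "g \<in> boundaries W E j"
  then obtain f where f: "f \<in> chains W E (Suc j)" "g = bnd W f" by (auto simp: boundaries_def)
  have g: "g \<in> chains W E j" using bnd_chains f by blast
  have "bnd W g \<tau> = 0" for \<tau>
  proof (cases "finite \<tau>")
    case True
    then show ?thesis using bnd_bnd assms f by blast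
  next
    case False
    then have "insert v \<tau> \<notin> cliques W E j" for v
      using assms by (auto simp: cliques_def dest: finite_subset)
    then show ?thesis using g by (auto simp: bnd_def chains_def)
  qed
  then show "g \<in> cycles W E j" using g by (auto simp: cycles_def)
qed

definition face_chain :: "nat set \<Rightarrow> nat set \<Rightarrow> 'k::field" where
  "face_chain \<sigma> \<tau> = (if \<tau> = \<sigma> then 1 else 0)"

lemma sum_fun_apply: "(\<Sum>i\<in>I. g i) x = (\<Sum>i\<in>I. g i x)" for g :: "'i \<Rightarrow> 'a \<Rightarrow> 'b::comm_monoid_add"
  by (induction I rule: infinite_finite_induct) auto

lemma chains_subset_span:
  assumes "finite W"
  shows "(chains W E j :: (nat set \<Rightarrow> 'k::field) set) \<subseteq> fs.span (face_chain ` cliques W E j)"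
proof
  fix f :: "nat set \<Rightarrow> 'k" assume f: "f \<in> chains W E j"
  have "f \<tau> = (\<Sum>\<sigma>\<in>cliques W E j. (\<lambda>x. f \<sigma> * face_chain \<sigma> x)) \<tau>" for \<tau>
    using f by (auto simp: sum_fun_apply face_chain_def chains_def if_distrib cliques_finite[OF assms] cong: if_cong)
  then have "f = (\<Sum>\<sigma>\<in>cliques W E j. (\<lambda>x. f \<sigma> * face_chain \<sigma> x))" by blast
  also have "\<dots> \<in> fs.span (face_chain ` cliques W E j)"
    by (intro fs.span_sum fs.span_scale fs.span_base) auto
  finally show "f \<in> fs.span (face_chain ` cliques W E j)" .
qed

lemma red_betti_eq:
  assumes "finite W"
  shows "red_betti (K :: 'k::field itself) W E j =
    fs.dim (cycles W E j :: (nat set \<Rightarrow> 'k) set) - fs.dim (boundaries W E j :: (nat set \<Rightarrow> 'k) set)"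
proof -
  have "{f \<in> (chains W E j :: (nat set \<Rightarrow> 'k) set). bd W E j f = 0} = cycles W E j"
  proof (cases j)
    case 0
    then show ?thesis using bnd_chains_0[OF _ assms, of _ E W]
      by (auto simp: cycles_def bd_def)
  next
    case (Suc i)
    then show ?thesis using bd_Suc_eq_bnd[OF assms order_refl, where ?'k='k, of _ E i]
      by (auto simp: cycles_def)
  qed
  moreover have "bd W E (Suc j) ` (chains W E (Suc j) :: (nat set \<Rightarrow> 'k) set) = boundaries W E j"
    using bd_Suc_eq_bnd[OF assms order_refl, of _ E j] by (auto simp: boundaries_def)
  ultimately show ?thesis by (simp add: red_betti_def fdim_eq_dim)
qed

lemma cycles_subset_span:
  assumes "finite W"
  shows "(cycles W E j :: (nat set \<Rightarrow> 'k::field) set) \<subseteq> fs.span (face_chain ` cliques W E j)"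
  using chains_subset_span[OF assms] by (auto simp: cycles_def)

text \<open>Homology is handled through cycles that generate it modulo boundaries, without forming
  quotients: upper bounds come from this lemma, and \<open>red_betti_generators\<close> is its
  converse.\<close>

lemma red_betti_leI:
  fixes F :: "(nat set \<Rightarrow> 'k::field) set"
  assumes "finite W" "finite F" "cycles W E j \<subseteq> fs.span (boundaries W E j \<union> F)"
  shows "red_betti (K :: 'k itself) W E j \<le> card F"
proof -
  have "fs.dim (cycles W E j :: (nat set \<Rightarrow> 'k) set)
      \<le> fs.dim (boundaries W E j :: (nat set \<Rightarrow> 'k) set) + card F"
  proof (rule fs.dim_le_dim_plus_card)
    show "finite (face_chain ` cliques W E j :: (nat set \<Rightarrow> 'k) set)"
      using cliques_finite[OF assms(1)] by simp
    show "boundaries W E j \<subseteq> fs.span (face_chain ` cliques W E j :: (nat set \<Rightarrow> 'k) set)"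
      using boundaries_subset_cycles[OF assms(1)] cycles_subset_span[OF assms(1)] by (rule subset_trans)
  qed (use assms in auto)
  then show ?thesis by (simp add: red_betti_eq[OF assms(1)])
qed

lemma red_betti_generators:
  assumes "finite W"
  obtains F :: "(nat set \<Rightarrow> 'k::field) set"
  where "F \<subseteq> cycles W E j" "finite F" "card F \<le> red_betti (K :: 'k itself) W E j"
    "cycles W E j \<subseteq> fs.span (boundaries W E j \<union> F)"
proof -
  have "finite (face_chain ` cliques W E j :: (nat set \<Rightarrow> 'k) set)"
    using cliques_finite[OF assms] by simp
  from fs.spanning_modulo_dim_diff[OF this cycles_subset_span[OF assms] boundaries_subset_cycles[OF assms]]
  obtain F :: "(nat set \<Rightarrow> 'k) set" where "F \<subseteq> cycles W E j" "finite F"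
    "card F \<le> fs.dim (cycles W E j :: (nat set \<Rightarrow> 'k) set) - fs.dim (boundaries W E j :: (nat set \<Rightarrow> 'k) set)"
    "cycles W E j \<subseteq> fs.span (boundaries W E j \<union> F)"
    by metis
  then show thesis using that red_betti_eq[OF assms, of K E j] by metis
qed

lemma red_betti_eq_0I:
  assumes "finite W" "(cycles W E j :: (nat set \<Rightarrow> 'k::field) set) \<subseteq> boundaries W E j"
  shows "red_betti (K :: 'k itself) W E j = 0"
proof -
  have "cycles W E j \<subseteq> fs.span (boundaries W E j \<union> {} :: (nat set \<Rightarrow> 'k) set)"
    unfolding Un_empty_right using assms(2) fs.span_superset by (rule subset_trans)
  from red_betti_leI[OF assms(1) _ this] show ?thesis by simp
qed

lemma red_betti_le_card_cliques:
  assumes "finite W"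
  shows "red_betti (K :: 'k::field itself) W E j \<le> card (cliques W E j)"
proof -
  have "red_betti K W E j \<le> card (face_chain ` cliques W E j :: (nat set \<Rightarrow> 'k) set)"
  proof (rule red_betti_leI[OF assms])
    show "finite (face_chain ` cliques W E j :: (nat set \<Rightarrow> 'k) set)"
      using cliques_finite[OF assms] by simp
    show "cycles W E j \<subseteq> fs.span (boundaries W E j \<union> face_chain ` cliques W E j :: (nat set \<Rightarrow> 'k) set)"
      using cycles_subset_span[OF assms] fs.span_mono[OF Un_upper2] by (rule subset_trans)
  qed
  also have "\<dots> \<le> card (cliques W E j)" by (intro card_image_le cliques_finite assms)
  finally show ?thesis .
qed

section \<open>Cones and the Mayer-Vietoris inequality\<close>

text \<open>A cycle \<open>z\<close> is the boundary of the cone \<open>h\<close> with apex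
  \<open>w\<close> over the part of \<open>z\<close> on faces avoiding \<open>w\<close>. On faces
  avoiding \<open>w\<close> this is immediate; on faces containing \<open>w\<close> it follows from
  \<open>bnd W z = 0\<close>.\<close>

lemma red_betti_cone:
  assumes W: "finite W" "w \<in> W" and adj: "\<And>x. x \<in> W \<Longrightarrow> x \<noteq> w \<Longrightarrow> E w x \<and> E x w"
  shows "red_betti (K :: 'k::field itself) W E j = 0"
proof (rule red_betti_eq_0I[OF W(1)], rule subsetI)
  fix z :: "nat set \<Rightarrow> 'k" assume "z \<in> cycles W E j"
  then have z: "z \<in> chains W E j" "bnd W z = 0" by (auto simp: cycles_def)
  define h :: "nat set \<Rightarrow> 'k" where
    "h \<sigma> = (if w \<in> \<sigma> then face_sign w (\<sigma> - {w}) * z (\<sigma> - {w}) else 0)" for \<sigma>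
  have "h \<in> chains W E (Suc j)"
  proof -
    have "h \<sigma> = 0" if "\<sigma> \<notin> cliques W E (Suc j)" for \<sigma>
    proof (cases "w \<in> \<sigma>")
      case True
      have "\<sigma> - {w} \<notin> cliques W E j"
      proof
        assume *: "\<sigma> - {w} \<in> cliques W E j"
        then have "finite (\<sigma> - {w})" using W by (auto simp: cliques_def dest: finite_subset)
        then have "card \<sigma> = Suc (card (\<sigma> - {w}))"
          using True card_Suc_Diff1[of \<sigma> w] by simp
        moreover have "\<sigma> \<subseteq> W" using * W(2) by (auto simp: cliques_def)
        moreover have "E x y" if "x \<in> \<sigma>" "y \<in> \<sigma>" "x \<noteq> y" for x y
          using * that \<open>\<sigma> \<subseteq> W\<close> adj by (cases "x = w \<or> y = w") (auto simp: cliques_def)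
        ultimately have "\<sigma> \<in> cliques W E (Suc j)" using * by (auto simp: cliques_def)
        then show False using that by simp
      qed
      then show ?thesis using z by (simp add: h_def chains_def)
    qed (simp add: h_def)
    then show ?thesis by (simp add: chains_def)
  qed
  moreover have "bnd W h \<tau> = z \<tau>" for \<tau>
  proof (cases "finite \<tau>")
    case False
    then have "insert v \<tau> \<notin> cliques W E i" "\<tau> \<notin> cliques W E i" for v i
      using W by (auto simp: cliques_def dest: finite_subset)
    then show ?thesis
      using z \<open>h \<in> chains W E (Suc j)\<close> by (simp add: bnd_def chains_def)
  next
    case fin: True
    show ?thesis
    proof (cases "w \<in> \<tau>")
      case False
      have "bnd W h \<tau> = (\<Sum>v\<in>{w}. face_sign v \<tau> * h (insert v \<tau>))"
        unfolding bnd_def using W False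
        by (intro sum.mono_neutral_right) (auto simp: h_def)
      also have "\<dots> = z \<tau>" using False by (simp add: h_def mult.assoc[symmetric])
      finally show ?thesis .
    next
      case True
      define \<rho> where "\<rho> = \<tau> - {w}"
      have \<rho>: "\<tau> = insert w \<rho>" "w \<notin> \<rho>" "finite \<rho>" using True fin by (auto simp: \<rho>_def)
      have eq: "face_sign v \<tau> * h (insert v \<tau>) = - face_sign w \<rho> * (face_sign v \<rho> * z (insert v \<rho>))"
        if v: "v \<in> W - \<tau>" for v
      proof -
        have 1: "insert v \<tau> - {w} = insert v \<rho>" using v \<rho> by auto
        have "face_sign v (insert w \<rho>) * face_sign w (insert v \<rho>) = - face_sign w \<rho> * (face_sign v \<rho> :: 'k)"
          using v \<rho> by (auto simp: face_sign_insert)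
        moreover have "h (insert v \<tau>) = face_sign w (insert v \<rho>) * z (insert v \<rho>)"
          using 1 True by (simp add: h_def)
        ultimately show ?thesis unfolding \<rho>(1) by (simp add: mult.assoc[symmetric])
      qed
      \<comment> \<open>The cycle condition at \<open>\<rho>\<close>, with the term
        \<open>v = w\<close> split off, expresses \<open>z \<tau>\<close> by values of
        \<open>z\<close> on faces without \<open>w\<close>.\<close>
      have "W - \<rho> = insert w (W - \<tau>)" using W \<rho> by auto
      then have "bnd W z \<rho> = (\<Sum>v\<in>insert w (W - \<tau>). face_sign v \<rho> * z (insert v \<rho>))"
        by (simp only: bnd_def)
      also have "\<dots> = face_sign w \<rho> * z \<tau> + (\<Sum>v\<in>W - \<tau>. face_sign v \<rho> * z (insert v \<rho>))"
        using W True \<open>\<tau> = insert w \<rho>\<close>[symmetric] by (subst sum.insert) simp_all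
      finally have 2: "(\<Sum>v\<in>W - \<tau>. face_sign v \<rho> * z (insert v \<rho>)) = - (face_sign w \<rho> * z \<tau>)"
        using z(2) by (simp add: eq_neg_iff_add_eq_0 add.commute)
      have "bnd W h \<tau> = (\<Sum>v\<in>W - \<tau>. - face_sign w \<rho> * (face_sign v \<rho> * z (insert v \<rho>)))"
        unfolding bnd_def by (rule sum.cong) (use eq in auto)
      also have "\<dots> = z \<tau>"
        using 2 by (simp only: sum_distrib_left[symmetric]) (simp add: mult.assoc[symmetric])
      finally show ?thesis .
    qed
  qed
  ultimately show "z \<in> boundaries W E j" unfolding boundaries_def by (metis ext image_eqI)
qed

text \<open>This is exactness of the Mayer-Vietoris sequence at the homology of \<open>V\<close>, in
  terms of generators: those of \<open>A\<close>, those of \<open>B\<close>, and lifts of generators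
  of the image of the connecting map.\<close>

lemma red_betti_Mayer_Vietoris:
  assumes V: "finite V" "A \<subseteq> V" "B \<subseteq> V"
    and cover: "\<And>\<sigma>. \<sigma> \<in> cliques V E (Suc j) \<Longrightarrow> \<sigma> \<subseteq> A \<or> \<sigma> \<subseteq> B"
  shows "red_betti (K :: 'k::field itself) V E (Suc j)
     \<le> red_betti K A E (Suc j) + red_betti K B E (Suc j) + red_betti K (A \<inter> B) E j"
proof -
  have finA: "finite A" and finB: "finite B" and finAB: "finite (A \<inter> B)" and AB: "A \<inter> B \<subseteq> V"
    using V finite_subset by blast+
  obtain FA :: "(nat set \<Rightarrow> 'k) set" where FA: "finite FA" "card FA \<le> red_betti K A E (Suc j)"
    "cycles A E (Suc j) \<subseteq> fs.span (boundaries A E (Suc j) \<union> FA)" "FA \<subseteq> cycles A E (Suc j)"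
    using red_betti_generators[OF finA, of E "Suc j" K] by metis
  obtain FB :: "(nat set \<Rightarrow> 'k) set" where FB: "finite FB" "card FB \<le> red_betti K B E (Suc j)"
    "cycles B E (Suc j) \<subseteq> fs.span (boundaries B E (Suc j) \<union> FB)" "FB \<subseteq> cycles B E (Suc j)"
    using red_betti_generators[OF finB, of E "Suc j" K] by metis
  obtain F0 :: "(nat set \<Rightarrow> 'k) set" where F0: "finite F0" "card F0 \<le> red_betti K (A \<inter> B) E j"
    "cycles (A \<inter> B) E j \<subseteq> fs.span (boundaries (A \<inter> B) E j \<union> F0)" "F0 \<subseteq> cycles (A \<inter> B) E j"
    using red_betti_generators[OF finAB, of E j K] by metis
  \<comment> \<open>The part of a chain inside \<open>A\<close>; by \<open>cover\<close> the
    remainder \<open>f - r f\<close> lives in \<open>B\<close>.\<close>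
  define r :: "(nat set \<Rightarrow> 'k) \<Rightarrow> nat set \<Rightarrow> 'k" where "r f = (\<lambda>\<sigma>. if \<sigma> \<subseteq> A then f \<sigma> else 0)" for f
  have r_add: "r (f + g) = r f + r g" and r_diff: "r (f - g) = r f - r g"
    and r_scale: "r (\<lambda>x. c * f x) = (\<lambda>x. c * r f x)" for f g c
    by (auto simp: r_def fun_eq_iff)
  have rA: "r f \<in> chains A E (Suc j)" and rB: "f - r f \<in> chains B E (Suc j)"
    if "f \<in> chains V E (Suc j)" for f
  proof -
    have "f \<sigma> = 0" if "\<sigma> \<subseteq> A" "\<sigma> \<notin> cliques A E (Suc j)" for \<sigma>
      using that \<open>f \<in> chains V E (Suc j)\<close> by (auto simp: chains_def cliques_def)
    then show "r f \<in> chains A E (Suc j)" by (simp add: chains_def r_def)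
    have "f \<sigma> = 0" if "\<not> \<sigma> \<subseteq> A" "\<sigma> \<notin> cliques B E (Suc j)" for \<sigma>
    proof -
      have "\<sigma> \<notin> cliques V E (Suc j)" using that cover[of \<sigma>] by (auto simp: cliques_def)
      then show ?thesis using \<open>f \<in> chains V E (Suc j)\<close> by (simp add: chains_def)
    qed
    then show "f - r f \<in> chains B E (Suc j)" by (simp add: chains_def r_def)
  qed
  have bA: "bnd V f = bnd A f" if "f \<in> chains A E i" for f :: "nat set \<Rightarrow> 'k" and i
    using that V by (rule_tac bnd_ambient) auto
  have bB: "bnd V f = bnd B f" if "f \<in> chains B E i" for f :: "nat set \<Rightarrow> 'k" and i
    using that V by (rule_tac bnd_ambient) auto
  have bAB: "bnd V f = bnd (A \<inter> B) f" if "f \<in> chains (A \<inter> B) E i" for f :: "nat set \<Rightarrow> 'k" and i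
    using that V AB by (rule_tac bnd_ambient) auto
  \<comment> \<open>The connecting map. For a cycle \<open>z\<close> the boundary of the
    \<open>A\<close>-part is minus that of the \<open>B\<close>-part, hence a chain on
    \<open>A \<inter> B\<close>.\<close>
  define \<delta> where "\<delta> z = bnd V (r z)" for z
  have \<delta>: "\<delta> z \<in> cycles (A \<inter> B) E j" if z: "z \<in> cycles V E (Suc j)" for z
  proof -
    have zc: "z \<in> chains V E (Suc j)" and z0: "bnd V z = 0" using z by (auto simp: cycles_def)
    have 1: "\<delta> z \<in> chains A E j" using bnd_chains[OF rA[OF zc]] by (simp add: \<delta>_def)
    have "\<delta> z = - bnd V (z - r z)" using z0 by (simp add: \<delta>_def bnd_diff del: minus_apply)
    then have "- \<delta> z \<in> chains B E j" using bnd_chains[OF rB[OF zc], of V] by simp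
    then have 2: "\<delta> z \<in> chains B E j" by (auto simp: chains_def)
    have "\<delta> z \<in> boundaries A E j" using rA[OF zc] bA by (auto simp: boundaries_def \<delta>_def)
    then have "bnd A (\<delta> z) = 0" using boundaries_subset_cycles[OF finA] by (auto simp: cycles_def)
    then have "bnd V (\<delta> z) = 0" using bA 1 by metis
    then show ?thesis using 1 2 bAB[of "\<delta> z" j] by (auto simp: cycles_def chains_Int)
  qed
  have bds: "boundaries (A \<inter> B) E j \<subseteq> fs.span (face_chain ` cliques (A \<inter> B) E j :: (nat set \<Rightarrow> 'k) set)"
    using boundaries_subset_cycles[OF finAB] cycles_subset_span[OF finAB] by blast
  have "\<delta> ` cycles V E (Suc j) \<subseteq> fs.span (boundaries (A \<inter> B) E j \<union> F0)"
    using \<delta> F0(3) by blast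
  then obtain F' where F': "F' \<subseteq> \<delta> ` cycles V E (Suc j)" "finite F'" "card F' \<le> card F0"
    "\<delta> ` cycles V E (Suc j) \<subseteq> fs.span (boundaries (A \<inter> B) E j \<union> F')"
    using fs.spanning_modulo_subset[OF _ bds F0(1)] cliques_finite[OF finAB] by (metis finite_imageI)
  \<comment> \<open>Since \<open>F'\<close> was chosen inside the image of \<open>\<delta>\<close>,
    its elements lift to cycles of \<open>V\<close>.\<close>
  obtain T where T: "T \<subseteq> cycles V E (Suc j)" "finite T" "card T = card F'" "\<delta> ` T = F'"
    using F'(1,2) by (metis subset_image_inj card_image finite_imageD)
  \<comment> \<open>\<open>Y\<close> turns membership in a span into an explicit form:
    \<open>\<delta>\<close> of a combination of the lifts, plus the boundary of a chain
    \<open>e\<close> on \<open>A \<inter> B\<close>.\<close>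
  define Y where "Y = {\<delta> t + bnd V e |t e. t \<in> fs.span T \<and> e \<in> chains (A \<inter> B) E (Suc j)}"
  have "r 0 = 0" by (simp add: r_def fun_eq_iff)
  then have \<delta>_0: "\<delta> 0 = 0" by (simp add: \<delta>_def)
  have "fs.subspace Y"
    unfolding fs.subspace_def
  proof (intro conjI ballI allI)
    have "0 = \<delta> 0 + bnd V 0" by (simp add: \<delta>_0)
    then show "0 \<in> Y" unfolding Y_def
      using fs.span_zero fs.subspace_0[OF chains_subspace[where ?'k='k]] by blast
  next
    fix x y assume "x \<in> Y" "y \<in> Y"
    then obtain t e t' e' where *: "x = \<delta> t + bnd V e" "t \<in> fs.span T" "e \<in> chains (A \<inter> B) E (Suc j)"
      "y = \<delta> t' + bnd V e'" "t' \<in> fs.span T" "e' \<in> chains (A \<inter> B) E (Suc j)"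
      by (auto simp: Y_def)
    have "x + y = \<delta> (t + t') + bnd V (e + e')"
      by (simp add: * \<delta>_def r_add bnd_add algebra_simps del: plus_fun_apply)
    then show "x + y \<in> Y" unfolding Y_def
      using * fs.span_add fs.subspace_add[OF chains_subspace[where ?'k='k]] by blast
  next
    fix c x assume "x \<in> Y"
    then obtain t e where *: "x = \<delta> t + bnd V e" "t \<in> fs.span T" "e \<in> chains (A \<inter> B) E (Suc j)"
      by (auto simp: Y_def)
    have "(\<lambda>u. c * x u) = \<delta> (\<lambda>u. c * t u) + bnd V (\<lambda>u. c * e u)"
      by (simp add: * \<delta>_def r_scale bnd_scale fun_eq_iff algebra_simps)
    then show "(\<lambda>u. c * x u) \<in> Y" unfolding Y_def
      using * fs.span_scale[of t T c] fs.subspace_scale[OF chains_subspace[where ?'k='k], of e _ _ _ c] by blast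
  qed
  moreover have "boundaries (A \<inter> B) E j \<subseteq> Y"
  proof
    fix x :: "nat set \<Rightarrow> 'k" assume "x \<in> boundaries (A \<inter> B) E j"
    then obtain e where e: "e \<in> chains (A \<inter> B) E (Suc j)" "x = bnd V e"
      using bAB by (auto simp: boundaries_def)
    have "x = \<delta> 0 + bnd V e" using e by (simp add: \<delta>_0)
    then show "x \<in> Y" unfolding Y_def using e fs.span_zero by blast
  qed
  moreover have "F' \<subseteq> Y"
  proof
    fix x assume "x \<in> F'"
    then obtain t where t: "t \<in> T" "x = \<delta> t + bnd V 0" using T(4) by auto
    then show "x \<in> Y" unfolding Y_def
      using fs.span_base fs.subspace_0[OF chains_subspace[where ?'k='k]] by blast
  qed
  ultimately have Y: "fs.span (boundaries (A \<inter> B) E j \<union> F') \<subseteq> Y"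
    by (intro fs.span_minimal) auto
  define S where "S = boundaries V E (Suc j) \<union> (FA \<union> FB \<union> T)"
  have bdA: "boundaries A E (Suc j) \<subseteq> (boundaries V E (Suc j) :: (nat set \<Rightarrow> 'k) set)"
    unfolding boundaries_def using bA chains_mono[OF V(2)] by (metis image_cong image_mono)
  have bdB: "boundaries B E (Suc j) \<subseteq> (boundaries V E (Suc j) :: (nat set \<Rightarrow> 'k) set)"
    unfolding boundaries_def using bB chains_mono[OF V(3)] by (metis image_cong image_mono)
  have "cycles V E (Suc j) \<subseteq> fs.span S"
  proof
    fix z :: "nat set \<Rightarrow> 'k" assume z: "z \<in> cycles V E (Suc j)"
    then have "\<delta> z \<in> Y" using F'(4) Y by blast
    then obtain t e where te: "\<delta> z = \<delta> t + bnd V e" "t \<in> fs.span T" "e \<in> chains (A \<inter> B) E (Suc j)"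
      by (auto simp: Y_def)
    have eA: "e \<in> chains A E (Suc j)" and eB: "e \<in> chains B E (Suc j)"
      using te(3) by (auto simp: chains_Int)
    have tz: "t \<in> cycles V E (Suc j)"
      using te(2) T(1) fs.span_minimal[OF _ cycles_subspace[where ?'k='k]] by blast
    \<comment> \<open>Now \<open>\<delta> y\<close> is the boundary of \<open>e\<close>. Shifting
      \<open>e\<close> from one part to the other makes both \<open>r y - e\<close> and
      \<open>(y - r y) + e\<close> cycles, in \<open>A\<close> and in \<open>B\<close>, with sum
      \<open>y\<close>.\<close>
    define y where "y = z - t"
    have y: "y \<in> cycles V E (Suc j)"
      unfolding y_def using z tz cycles_subspace by (rule_tac fs.subspace_diff)
    then have yc: "y \<in> chains V E (Suc j)" and y0: "bnd V y = 0" by (auto simp: cycles_def)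
    have ry: "bnd V (r y) = bnd V e"
      using te(1) by (simp add: y_def \<delta>_def r_diff bnd_diff del: minus_apply)
    have yA: "r y - e \<in> chains A E (Suc j)"
      using rA[OF yc] eA fs.subspace_diff[OF chains_subspace[where ?'k='k]] by blast
    moreover have "bnd V (r y - e) = 0" using ry by (simp add: bnd_diff del: minus_apply)
    ultimately have "r y - e \<in> cycles A E (Suc j)" using bA by (auto simp: cycles_def)
    then have 1: "r y - e \<in> fs.span S"
      using FA(3) bdA fs.span_mono[of "boundaries A E (Suc j) \<union> FA" S] by (auto simp: S_def)
    have yB: "(y - r y) + e \<in> chains B E (Suc j)"
      using rB[OF yc] eB fs.subspace_add[OF chains_subspace[where ?'k='k]] by blast
    moreover have "bnd V ((y - r y) + e) = 0"
      using ry y0 by (simp add: bnd_diff bnd_add del: minus_apply plus_fun_apply)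
    ultimately have "(y - r y) + e \<in> cycles B E (Suc j)" using bB by (auto simp: cycles_def)
    then have 2: "(y - r y) + e \<in> fs.span S"
      using FB(3) bdB fs.span_mono[of "boundaries B E (Suc j) \<union> FB" S] by (auto simp: S_def)
    have 3: "t \<in> fs.span S" using te(2) fs.span_mono[of T S] by (auto simp: S_def)
    have "z = ((r y - e) + ((y - r y) + e)) + t" by (simp add: y_def fun_eq_iff)
    then show "z \<in> fs.span S" using 1 2 3 fs.span_add by metis
  qed
  then have "red_betti K V E (Suc j) \<le> card (FA \<union> FB \<union> T)"
    unfolding S_def using V FA FB T by (intro red_betti_leI) auto
  also have "\<dots> \<le> card FA + card FB + card T"
    by (meson add_le_mono1 card_Un_le le_trans)
  finally show ?thesis using FA(2) FB(2) T(3) F'(3) F0(2) by linarith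
qed

section \<open>Graphs without induced 4-cycles\<close>

text \<open>Index 0 is degree -1: the empty face is the boundary of any vertex
  \<open>v\<close>.\<close>

lemma red_betti_0_nonempty:
  assumes W: "finite W" "W \<noteq> {}"
  shows "red_betti (K :: 'k::field itself) W E 0 = 0"
proof (rule red_betti_eq_0I[OF W(1)], rule subsetI)
  fix z :: "nat set \<Rightarrow> 'k" assume "z \<in> cycles W E 0"
  then have z: "z \<tau> = 0" if "\<tau> \<noteq> {}" for \<tau>
  proof -
    have "\<tau> \<notin> cliques W E 0" using that W by (auto simp: cliques_def dest: finite_subset)
    then show ?thesis using \<open>z \<in> cycles W E 0\<close> by (simp add: cycles_def chains_def)
  qed
  obtain v where v: "v \<in> W" using W by auto
  define h where "h \<sigma> = (if \<sigma> = {v} then z {} else 0)" for \<sigma>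
  have "h \<in> chains W E (Suc 0)" using v by (auto simp: h_def chains_def cliques_def)
  moreover have "bnd W h \<tau> = z \<tau>" for \<tau>
  proof (cases "\<tau> = {}")
    case True
    have "bnd W h \<tau> = (\<Sum>u\<in>{v}. face_sign u \<tau> * h (insert u \<tau>))"
      unfolding bnd_def using W v True by (intro sum.mono_neutral_right) (auto simp: h_def)
    then show ?thesis using True by (simp add: h_def face_sign_def)
  next
    case False
    then have "insert u \<tau> \<noteq> {v}" if "u \<notin> \<tau>" for u using that by auto
    then have "h (insert u \<tau>) = 0" if "u \<notin> \<tau>" for u using that h_def by presburger
    then show ?thesis using z[OF False] by (simp add: bnd_def)
  qed
  ultimately show "z \<in> boundaries W E 0" unfolding boundaries_def by (metis ext image_eqI)
qed

lemma red_betti_0_le_1: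
  assumes "finite W"
  shows "red_betti (K :: 'k::field itself) W E 0 \<le> 1"
proof -
  have "\<sigma> = {}" if "\<sigma> \<in> cliques W E 0" for \<sigma>
    using that finite_subset[OF _ assms, of \<sigma>] by (simp add: cliques_def)
  then have "cliques W E 0 \<subseteq> {{}}" by blast
  from card_mono[OF _ this] have "card (cliques W E 0) \<le> 1" by simp
  then show ?thesis using red_betti_le_card_cliques[OF assms, of K E 0] by simp
qed

lemma red_betti_large:
  assumes "finite W" "card W < j"
  shows "red_betti (K :: 'k::field itself) W E j = 0"
proof -
  have "\<sigma> \<notin> cliques W E j" for \<sigma>
    using assms(2) card_mono[OF assms(1), of \<sigma>] by (auto simp: cliques_def)
  then have "cliques W E j = {}" by blast
  then show ?thesis using red_betti_le_card_cliques[OF assms(1), of K E j] by simp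
qed

section \<open>Removing vertices and cliques\<close>

definition clique_set :: "(nat \<Rightarrow> nat \<Rightarrow> bool) \<Rightarrow> nat set \<Rightarrow> bool" where
  "clique_set E Q \<longleftrightarrow> (\<forall>x\<in>Q. \<forall>y\<in>Q. x \<noteq> y \<longrightarrow> E x y)"

definition nbhd :: "(nat \<Rightarrow> nat \<Rightarrow> bool) \<Rightarrow> nat set \<Rightarrow> nat set \<Rightarrow> nat set" where
  "nbhd E W Q = {x \<in> W - Q. \<exists>q\<in>Q. E x q}"

text \<open>Induced subgraphs are represented by subsets \<open>W\<close> of \<open>V\<close> with
  the same relation \<open>E\<close>.\<close>

locale C4_free_graph =
  fixes V :: "nat set" and E :: "nat \<Rightarrow> nat \<Rightarrow> bool"
  assumes finite_V: "finite V"
    and E_sym: "E x y \<Longrightarrow> E y x"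
    and E_irrefl: "\<not> E x x"
    and C4_free: "induced_C4_free V E"
begin

lemma finite_sub: "W \<subseteq> V \<Longrightarrow> finite W"
  using finite_V finite_subset by blast

lemma no_induced_C4:
  assumes "{a,b,c,d} \<subseteq> V" "E a b" "E b c" "E c d" "E d a" "a \<noteq> c" "b \<noteq> d"
  shows "E a c \<or> E b d"
proof (rule ccontr)
  assume *: "\<not> (E a c \<or> E b d)"
  have "a \<noteq> b" "b \<noteq> c" "c \<noteq> d" "d \<noteq> a" using assms(2-5) E_irrefl by metis+
  then have "distinct [a,b,c,d] \<and> E a b \<and> E b c \<and> E c d \<and> E d a \<and> \<not> E a c \<and> \<not> E b d"
    using assms(2-7) * by simp
  moreover have "a \<in> V" "b \<in> V" "c \<in> V" "d \<in> V" using assms(1) by auto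
  ultimately have "\<exists>a\<in>V. \<exists>b\<in>V. \<exists>c\<in>V. \<exists>d\<in>V.
      distinct [a, b, c, d] \<and> E a b \<and> E b c \<and> E c d \<and> E d a \<and> \<not> E a c \<and> \<not> E b d"
    by (intro bexI)
  then show False using C4_free unfolding induced_C4_free_def by (rule notE[rotated])
qed

text \<open>Two nonadjacent common neighbours \<open>x\<close>, \<open>y\<close> would make
  \<open>u, x, v, y\<close> an induced 4-cycle.\<close>

lemma common_nbhd_clique:
  assumes "u \<in> V" "v \<in> V" "u \<noteq> v" "\<not> E u v"
  shows "clique_set E {x\<in>V. E x u \<and> E x v}"
  unfolding clique_set_def
proof (intro ballI impI)
  fix x y assume "x \<in> {x\<in>V. E x u \<and> E x v}" "y \<in> {x\<in>V. E x u \<and> E x v}" "x \<noteq> y"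
  then have "E u x" "E x v" "E v y" "E y u" "x \<noteq> y" "{u,x,v,y} \<subseteq> V"
    using assms(1,2) by (auto intro: E_sym)
  from no_induced_C4[OF this(6,1-4) assms(3) this(5)] show "E x y" using assms(4) by simp
qed

text \<open>If \<open>x\<close> in \<open>Q\<close> sees only \<open>w\<close> and \<open>y\<close>
  in \<open>Q\<close> sees only \<open>w'\<close>, then \<open>w, x, y, w'\<close> is an induced
  4-cycle. The insertions account for \<open>w\<close> or \<open>w'\<close> lying in
  \<open>Q\<close> itself.\<close>

lemma clique_nbhds_nested:
  assumes "Q \<subseteq> V" "clique_set E Q" "w \<in> V" "w' \<in> V" "E w w'"
  shows "{q\<in>Q. E w q} \<subseteq> insert w' {q\<in>Q. E w' q} \<or> {q\<in>Q. E w' q} \<subseteq> insert w {q\<in>Q. E w q}"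
proof (rule ccontr)
  assume "\<not> ?thesis"
  then obtain x y where xy: "x \<in> Q" "E w x" "\<not> E w' x" "x \<noteq> w'" "y \<in> Q" "E w' y" "\<not> E w y" "y \<noteq> w"
    by blast
  then have "E x y" using assms(2) unfolding clique_set_def by metis
  moreover have "{w,x,y,w'} \<subseteq> V" "E y w'" "E w' w" "w \<noteq> y" "x \<noteq> w'" "\<not> E x w'"
    using xy assms(1,3-5) by (auto intro: E_sym dest: E_sym)
  ultimately show False using no_induced_C4[of w x y w'] xy by simp
qed

text \<open>Mayer-Vietoris for the deletion of \<open>v\<close> and the closed neighbourhood of
  \<open>v\<close>, which is a cone.\<close>

lemma red_betti_remove_vertex:
  assumes W: "W \<subseteq> V" "v \<in> W"
  shows "red_betti (K :: 'k::field itself) W E (Suc j)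
    \<le> red_betti K (W - {v}) E (Suc j) + red_betti K {x\<in>W. E x v} E j"
proof -
  let ?B = "insert v {x\<in>W. E x v}"
  have "red_betti K W E (Suc j) \<le> red_betti K (W - {v}) E (Suc j)
      + red_betti K ?B E (Suc j) + red_betti K ((W - {v}) \<inter> ?B) E j"
    using W finite_sub by (intro red_betti_Mayer_Vietoris) (auto simp: cliques_def)
  moreover have "red_betti K ?B E (Suc j) = 0"
    using W finite_sub[OF W(1)] E_sym by (intro red_betti_cone[of _ v]) auto
  moreover have "(W - {v}) \<inter> ?B = {x\<in>W. E x v}" using E_irrefl by auto
  ultimately show ?thesis by simp
qed

text \<open>Attach the vertices outside \<open>Q\<close> in order of decreasing neighbourhood in \<open>Q\<close>: as these
  neighbourhoods are nested along edges, each vertex is attached along a cone.\<close>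

lemma red_betti_closed_nbhd_clique:
  assumes "Q \<subseteq> W" "W \<subseteq> V" "clique_set E Q" "Q \<noteq> {}" "\<And>w. w \<in> W - Q \<Longrightarrow> \<exists>q\<in>Q. E w q"
  shows "red_betti (K :: 'k::field itself) W E j = 0"
  using assms
proof (induction "card (W - Q)" arbitrary: W j rule: less_induct)
  case less
  have finW: "finite W" and finQ: "finite Q" using less.prems finite_sub by auto
  show ?case
  proof (cases "W = Q")
    case True
    obtain q where "q \<in> Q" using less.prems by auto
    then show ?thesis using True finQ less.prems(3)
      by (intro red_betti_cone[of _ q]) (auto simp: clique_set_def)
  next
    case False
    define d where "d w = card {q\<in>Q. E w q}" for w
    obtain w0 where "w0 \<in> W - Q" using False less.prems(1) by auto
    then have "\<exists>w. w \<in> W - Q \<and> (\<forall>w'. w' \<in> W - Q \<longrightarrow> d w \<le> d w')"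
      by (rule ex_has_least_nat)
    then obtain w where w: "w \<in> W - Q" and dmin: "\<And>w'. w' \<in> W - Q \<Longrightarrow> d w \<le> d w'" by blast
    obtain q where q: "q \<in> Q" "E w q" using less.prems(5) w by blast
    let ?N = "{x\<in>W. E x w}"
    have nonempty: "W \<noteq> {}" using w by auto
    have "red_betti K ?N E i = 0" for i
    proof (rule red_betti_cone[of _ q])
      show "finite ?N" "q \<in> ?N" using finW q less.prems(1) E_sym by auto
      fix x assume x: "x \<in> ?N" "x \<noteq> q"
      have "E x q"
      proof (cases "x \<in> Q")
        case True
        then show ?thesis using q x less.prems(3) by (auto simp: clique_set_def)
      next
        case xQ: False
        have "{q\<in>Q. E w q} \<subseteq> {q\<in>Q. E x q} \<or> {q\<in>Q. E x q} \<subseteq> {q\<in>Q. E w q}"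
        proof -
          have "E w x" "w \<in> V" "x \<in> V" "Q \<subseteq> V" "w \<notin> Q" using x w less.prems E_sym by auto
          from clique_nbhds_nested[OF this(4) less.prems(3) this(2,3,1)] this(5) xQ
          show ?thesis by blast
        qed
        moreover have "d w \<le> d x" using dmin xQ x by auto
        moreover have "finite {q\<in>Q. E w q}" using finQ by simp
        \<comment> \<open>Of the two possible inclusions, the reverse one is an equality because
          \<open>w\<close> has the fewest neighbours in \<open>Q\<close>.\<close>
        ultimately have "{q\<in>Q. E w q} \<subseteq> {q\<in>Q. E x q}"
          unfolding d_def using card_seteq[OF \<open>finite {q\<in>Q. E w q}\<close>, of "{q\<in>Q. E x q}"] by blast
        then show ?thesis using q by auto
      qed
      then show "E q x \<and> E x q" using E_sym by blast
    qed
    moreover have "red_betti K (W - {w}) E i = 0" for i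
    proof (rule less.hyps)
      have "W - {w} - Q \<subset> W - Q" using w by auto
      then show "card (W - {w} - Q) < card (W - Q)" using finW by (simp add: psubset_card_mono)
    qed (use less.prems w in auto)
    ultimately have "red_betti K W E (Suc i) = 0" for i
      using red_betti_remove_vertex[of W w K i] less.prems(2) w by simp
    then show ?thesis
      using red_betti_0_nonempty[OF finW nonempty] by (cases j) auto
  qed
qed

text \<open>Mayer-Vietoris for \<open>W - Q\<close> and the closed neighbourhood of
  \<open>Q\<close>: a clique meeting \<open>Q\<close> lies in the latter, which is acyclic.\<close>

lemma red_betti_remove_clique:
  assumes W: "W \<subseteq> V" "Q \<subseteq> W" and Q: "clique_set E Q" "Q \<noteq> {}"
  shows "red_betti (K :: 'k::field itself) W E (Suc j)
    \<le> red_betti K (W - Q) E (Suc j) + red_betti K (nbhd E W Q) E j"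
proof -
  let ?B = "Q \<union> nbhd E W Q"
  have "red_betti K W E (Suc j) \<le> red_betti K (W - Q) E (Suc j)
      + red_betti K ?B E (Suc j) + red_betti K ((W - Q) \<inter> ?B) E j"
  proof (rule red_betti_Mayer_Vietoris)
    fix \<sigma> assume "\<sigma> \<in> cliques W E (Suc j)"
    then have \<sigma>: "\<sigma> \<subseteq> W" "\<And>x y. x \<in> \<sigma> \<Longrightarrow> y \<in> \<sigma> \<Longrightarrow> x \<noteq> y \<Longrightarrow> E x y"
      by (auto simp: cliques_def)
    show "\<sigma> \<subseteq> W - Q \<or> \<sigma> \<subseteq> ?B"
    proof (cases "\<sigma> \<inter> Q = {}")
      case False
      then obtain q where q: "q \<in> \<sigma>" "q \<in> Q" by blast
      have "x \<in> ?B" if "x \<in> \<sigma>" for x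
        using \<sigma>(1) \<sigma>(2)[OF that q(1)] that q(2) by (cases "x \<in> Q") (auto simp: nbhd_def)
      then show ?thesis by blast
    qed (use \<sigma>(1) in auto)
  qed (use W finite_sub[OF W(1)] in \<open>auto simp: nbhd_def\<close>)
  moreover have "red_betti K ?B E (Suc j) = 0"
    using W Q by (intro red_betti_closed_nbhd_clique[of Q]) (auto simp: nbhd_def)
  moreover have "(W - Q) \<inter> ?B = nbhd E W Q" by (auto simp: nbhd_def)
  ultimately show ?thesis by simp
qed

text \<open>Index \<open>Suc j\<close> is degree \<open>j\<close>. There is always a nonempty clique
  \<open>Q\<close> whose neighbourhood has at most 2/3 of the vertices. Deleting \<open>Q\<close>
  either preserves nonzero homology in the same degree, or \<open>nbhd E W Q\<close> has nonzero
  homology one degree lower, at the cost of a factor 3/2 in size.\<close>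

lemma red_betti_nonzero_imp_card_ge:
  assumes "W \<subseteq> V" "red_betti (K :: 'k::field itself) W E (Suc j) \<noteq> 0"
  shows "(3/2) ^ j \<le> real (card W)"
  using assms
proof (induction j arbitrary: W)
  case 0
  have "\<not> card W < 1" using 0 red_betti_large[OF finite_sub[OF 0(1)], of 1 K E] by auto
  then show ?case by simp
next
  case (Suc j)
  show ?case using Suc.prems
  proof (induction "card W" arbitrary: W rule: less_induct)
    case less
    have finW: "finite W" using less.prems finite_sub by auto
    let ?n = "real (card W)"
    let ?N = "\<lambda>v. {x\<in>W. E x v}"
    show ?case
    proof (cases "\<exists>Q. Q \<subseteq> W \<and> clique_set E Q \<and> Q \<noteq> {} \<and> real (card (nbhd E W Q)) \<le> 2/3 * ?n")
      case True
      then obtain Q where Q: "Q \<subseteq> W" "clique_set E Q" "Q \<noteq> {}" "real (card (nbhd E W Q)) \<le> 2/3 * ?n"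
        by blast
      have lt: "card (W - Q) < card W" using Q finW by (intro psubset_card_mono) auto
      show ?thesis
      proof (cases "red_betti K (W - Q) E (Suc (Suc j)) = 0")
        case False
        then have "(3/2) ^ Suc j \<le> real (card (W - Q))" using less.hyps[OF lt] less.prems by blast
        then show ?thesis using lt by linarith
      next
        case True
        then have "red_betti K (nbhd E W Q) E (Suc j) \<noteq> 0"
          using red_betti_remove_clique[of W Q K "Suc j"] Q less.prems by auto
        then have "(3/2) ^ j \<le> real (card (nbhd E W Q))"
          using Suc.IH[of "nbhd E W Q"] less.prems(1) by (auto simp: nbhd_def)
        then show ?thesis using Q(4) by simp
      qed
    next
      case False
      have "W \<noteq> {}" using less.prems(2) red_betti_large[of "{}" "Suc (Suc j)" K E] by auto
      have deg: "real (card (?N v)) > 2/3 * ?n" if "v \<in> W" for v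
      proof -
        have "nbhd E W {v} = ?N v" using E_irrefl by (auto simp: nbhd_def)
        moreover have "clique_set E {v}" by (simp add: clique_set_def)
        ultimately have "\<not> real (card (?N v)) \<le> 2/3 * ?n"
          using False that by (metis empty_subsetI insert_subset insert_not_empty)
        then show ?thesis by simp
      qed
      \<comment> \<open>\<open>Q = W\<close> would be admissible if \<open>W\<close> were a clique,
        so there are nonadjacent vertices.\<close>
      have "nbhd E W W = {}" by (auto simp: nbhd_def)
      then have "\<not> clique_set E W" using False \<open>W \<noteq> {}\<close> by auto
      then obtain u v where uv: "u \<in> W" "v \<in> W" "u \<noteq> v" "\<not> E u v" by (auto simp: clique_set_def)
      \<comment> \<open>All degrees exceed 2/3 of the size, so \<open>u\<close> and \<open>v\<close>
        share more than 1/3 of the vertices. These form a clique, and fewer than 2/3 of the vertices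
        lie outside it.\<close>
      define Q where "Q = ?N u \<inter> ?N v"
      have "card (?N u \<union> ?N v) \<le> card W" using finW by (intro card_mono) auto
      moreover have "card (?N u) + card (?N v) = card (?N u \<union> ?N v) + card Q"
        unfolding Q_def using finW by (intro card_Un_Int) auto
      ultimately have cQ: "real (card Q) > 1/3 * ?n" using deg[OF uv(1)] deg[OF uv(2)] by linarith
      then have "Q \<noteq> {}" by auto
      moreover have "Q \<subseteq> W" by (auto simp: Q_def)
      moreover have "clique_set E Q"
        using common_nbhd_clique[of u v] uv less.prems(1) by (auto simp: clique_set_def Q_def)
      moreover have "card (nbhd E W Q) \<le> card (W - Q)"
        using finW by (intro card_mono) (auto simp: nbhd_def)
      then have "real (card (nbhd E W Q)) \<le> 2/3 * ?n"
        using cQ card_Diff_subset[OF finite_subset[OF \<open>Q \<subseteq> W\<close> finW] \<open>Q \<subseteq> W\<close>]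
          card_mono[OF finW \<open>Q \<subseteq> W\<close>] by linarith
      ultimately show ?thesis using False by blast
    qed
  qed
qed

end

section \<open>Large cliques from large minimum degree\<close>

lemma clique_set_subset: "clique_set E A \<Longrightarrow> B \<subseteq> A \<Longrightarrow> clique_set E B"
  by (auto simp: clique_set_def)

context C4_free_graph
begin

lemma common_nbhd_clique_in:
  assumes "W \<subseteq> V" "u \<in> W" "v \<in> W" "u \<noteq> v" "\<not> E u v"
  shows "clique_set E {x\<in>W. E x u \<and> E x v}"
  by (rule clique_set_subset[OF common_nbhd_clique[of u v]]) (use assms in auto)

text \<open>Double counting of edges between \<open>W\<close> and \<open>S\<close>:
  \<open>d x\<close> counts neighbours of \<open>x\<close> in \<open>S\<close>, \<open>a s t\<close>
  counts common neighbours of \<open>s\<close> and \<open>t\<close>. For \<open>s \<noteq> t\<close>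
  these form a clique, so \<open>a s t \<le> m\<close>, while the degree condition makes the
  diagonal sum at least \<open>2 * card W\<close>.\<close>

lemma large_clique_of_independent:
  assumes W: "W \<subseteq> V" and S: "S \<subseteq> W" "card S = 2 * k" "\<And>x y. x \<in> S \<Longrightarrow> y \<in> S \<Longrightarrow> \<not> E x y"
    and k: "k > 0" and deg: "\<And>v. v \<in> S \<Longrightarrow> card W \<le> k * card {x\<in>W. E x v}"
    and m: "\<And>Q. Q \<subseteq> W \<Longrightarrow> clique_set E Q \<Longrightarrow> card Q \<le> m"
  shows "card W \<le> 2 * k\<^sup>2 * m"
proof -
  have finW: "finite W" and finS: "finite S" using W S finite_sub by auto
  define d where "d x = card {s\<in>S. E x s}" for x
  define a where "a s t = card {x\<in>W. E x s \<and> E x t}" for s t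
  have d_sum: "d x = (\<Sum>s\<in>S. of_bool (E x s))" for x
    using finS by (simp add: d_def Int_def conj_commute)
  have a_sum: "a s t = (\<Sum>x\<in>W. of_bool (E x s) * of_bool (E x t))" for s t
    using finW by (simp add: a_def Int_def of_bool_conj[symmetric] conj_commute)
  have 1: "(\<Sum>x\<in>W. d x) = (\<Sum>s\<in>S. a s s)"
    unfolding d_sum a_sum by (subst sum.swap) (simp add: of_bool_conj[symmetric])
  have 2: "(\<Sum>x\<in>W. d x * d x) = (\<Sum>s\<in>S. \<Sum>t\<in>S. a s t)"
  proof -
    have "(\<Sum>x\<in>W. d x * d x) = (\<Sum>x\<in>W. \<Sum>s\<in>S. \<Sum>t\<in>S. of_bool (E x s) * of_bool (E x t))"
      unfolding d_sum sum_product ..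
    also have "\<dots> = (\<Sum>s\<in>S. \<Sum>x\<in>W. \<Sum>t\<in>S. of_bool (E x s) * of_bool (E x t))"
      by (rule sum.swap)
    also have "\<dots> = (\<Sum>s\<in>S. \<Sum>t\<in>S. a s t)"
      unfolding a_sum by (intro sum.cong refl sum.swap)
    finally show ?thesis .
  qed
  \<comment> \<open>This says that \<open>(d x - 1) * (d x - 2)\<close> is nonnegative over the
    integers; it is a second-order inclusion-exclusion bound.\<close>
  have "3 * d x \<le> 2 + d x * d x" for x
  proof (cases "d x \<le> 2")
    case True
    then consider "d x = 0" | "d x = 1" | "d x = 2" by linarith
    then show ?thesis by cases simp_all
  next
    case False
    then have "3 * d x \<le> d x * d x" by (intro mult_right_mono) auto
    then show ?thesis by linarith
  qed
  then have "(\<Sum>x\<in>W. 3 * d x) \<le> (\<Sum>x\<in>W. 2 + d x * d x)" by (rule sum_mono)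
  then have 3: "3 * (\<Sum>s\<in>S. a s s) \<le> 2 * card W + (\<Sum>s\<in>S. \<Sum>t\<in>S. a s t)"
    unfolding 1[symmetric] 2[symmetric] by (simp add: sum_distrib_left sum.distrib sum_Suc)
  have off: "a s t \<le> m" if "s \<in> S" "t \<in> S - {s}" for s t
    unfolding a_def
  proof (rule m)
    show "clique_set E {x\<in>W. E x s \<and> E x t}"
      by (rule common_nbhd_clique_in[OF W]) (use that S in auto)
  qed auto
  have "(\<Sum>s\<in>S. \<Sum>t\<in>S. a s t) = (\<Sum>s\<in>S. a s s + (\<Sum>t\<in>S - {s}. a s t))"
    using finS by (intro sum.cong refl) (simp add: sum.remove)
  also have "\<dots> \<le> (\<Sum>s\<in>S. a s s + card S * m)"
  proof (intro sum_mono add_left_mono)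
    fix s assume s: "s \<in> S"
    have "(\<Sum>t\<in>S - {s}. a s t) \<le> card (S - {s}) * m"
      using off s by (intro sum_bounded_above[of _ _ m, simplified]) auto
    also have "\<dots> \<le> card S * m" using finS by (intro mult_right_mono card_mono) auto
    finally show "(\<Sum>t\<in>S - {s}. a s t) \<le> card S * m" .
  qed
  also have "\<dots> = (\<Sum>s\<in>S. a s s) + 4 * k\<^sup>2 * m"
    using S(2) by (simp add: sum.distrib power2_eq_square)
  finally have 4: "2 * (\<Sum>s\<in>S. a s s) \<le> 2 * card W + 4 * k\<^sup>2 * m" using 3 by linarith
  \<comment> \<open>The size \<open>2 * k\<close> of \<open>S\<close> yields the factor 2, so the
    diagonal sum outweighs the term \<open>2 * card W\<close> in the previous inequality.\<close>
  have "k * (2 * card W) = (\<Sum>s\<in>S. card W)" using S(2) by simp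
  also have "\<dots> \<le> (\<Sum>s\<in>S. k * a s s)"
    using deg by (intro sum_mono) (auto simp: a_def)
  also have "\<dots> = k * (\<Sum>s\<in>S. a s s)" by (simp add: sum_distrib_left)
  finally have "2 * card W \<le> (\<Sum>s\<in>S. a s s)" using k by simp
  then show ?thesis using 4 by linarith
qed

text \<open>\<open>W\<close> is covered by \<open>(card S)^2\<close> cliques \<open>C (s,t)\<close>:
  common neighbourhoods for \<open>s \<noteq> t\<close>, and for \<open>s = t\<close> the vertex
  \<open>s\<close> with those vertices whose only neighbour in \<open>S\<close> is \<open>s\<close>.
  Maximality gives each vertex outside \<open>S\<close> a neighbour in \<open>S\<close>.\<close>

lemma large_clique_of_max_independent:
  assumes W: "W \<subseteq> V" and S: "S \<subseteq> W" "\<And>x y. x \<in> S \<Longrightarrow> y \<in> S \<Longrightarrow> \<not> E x y"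
    and max: "\<And>T. T \<subseteq> W \<Longrightarrow> (\<And>x y. x \<in> T \<Longrightarrow> y \<in> T \<Longrightarrow> \<not> E x y) \<Longrightarrow> card T \<noteq> Suc (card S)"
    and m: "\<And>Q. Q \<subseteq> W \<Longrightarrow> clique_set E Q \<Longrightarrow> card Q \<le> m"
  shows "card W \<le> (card S)\<^sup>2 * m"
proof -
  have finW: "finite W" and finS: "finite S" using W S finite_sub by auto
  define C where "C = (\<lambda>(s,t). if s = t then insert s {x\<in>W. \<forall>u\<in>S. E x u \<longleftrightarrow> u = s} else {x\<in>W. E x s \<and> E x t})"
  have C_sub: "C p \<subseteq> W" if "p \<in> S \<times> S" for p using that S(1) by (auto simp: C_def split: if_splits)
  have "clique_set E (C p)" if "p \<in> S \<times> S" for p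
  proof -
    obtain s t where p: "p = (s,t)" "s \<in> S" "t \<in> S" using \<open>p \<in> S \<times> S\<close> by auto
    show ?thesis
    proof (cases "s = t")
      case False
      then have "clique_set E {x\<in>W. E x s \<and> E x t}"
        by (intro common_nbhd_clique_in[OF W]) (use p S in auto)
      then show ?thesis using False p(1) by (simp add: C_def)
    next
      case True
      show ?thesis unfolding clique_set_def
      proof (intro ballI impI, rule ccontr)
        fix x y assume xy: "x \<in> C p" "y \<in> C p" "x \<noteq> y" "\<not> E x y"
        have Cp: "C p = insert s {x\<in>W. \<forall>u\<in>S. E x u \<longleftrightarrow> u = s}" using True p(1) by (simp add: C_def)
        have s_nbrs: "x \<noteq> s" "y \<noteq> s"
          using xy p(2) unfolding Cp by (auto dest: E_sym)
        have x: "x \<in> W" "\<And>u. u \<in> S \<Longrightarrow> E x u \<longleftrightarrow> u = s" and y: "y \<in> W" "\<And>u. u \<in> S \<Longrightarrow> E y u \<longleftrightarrow> u = s"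
          using xy(1,2) s_nbrs unfolding Cp by auto
        have notS: "x \<notin> S" "y \<notin> S" using x(2)[OF p(2)] y(2)[OF p(2)] S(2)[OF _ p(2)] by auto
        \<comment> \<open>Exchanging \<open>s\<close> for two nonadjacent private neighbours would
          enlarge the independent set.\<close>
        let ?T = "insert x (insert y (S - {s}))"
        have cT: "card ?T = Suc (card S)"
          using notS xy(3) finS p(2) card_Suc_Diff1[of S s] by simp
        have TW: "?T \<subseteq> W" using x(1) y(1) S(1) by auto
        have "\<not> E a b" if "a \<in> ?T" "b \<in> ?T" for a b
        proof -
          have "\<not> E x u" "\<not> E u x" "\<not> E y u" "\<not> E u y" if "u \<in> S - {s}" for u
            using that x(2)[of u] y(2)[of u] by (auto dest: E_sym)
          moreover have "\<not> E y x" using xy(4) by (auto dest: E_sym)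
          ultimately show ?thesis using that xy(4) S(2) E_irrefl by auto
        qed
        from max[OF TW this] cT show False by simp
      qed
    qed
  qed
  then have cC: "card (C p) \<le> m" if "p \<in> S \<times> S" for p using m[OF C_sub[OF that]] that by simp
  have "W \<subseteq> (\<Union>p\<in>S \<times> S. C p)"
  proof
    fix x assume x: "x \<in> W"
    show "x \<in> (\<Union>p\<in>S \<times> S. C p)"
    proof (cases "x \<in> S")
      case True
      then have "x \<in> C (x,x)" by (simp add: C_def)
      then show ?thesis using True by blast
    next
      case False
      have "\<exists>s\<in>S. E x s"
      proof (rule ccontr)
        assume *: "\<not> (\<exists>s\<in>S. E x s)"
        have sub: "insert x S \<subseteq> W" using x S(1) by simp
        have "\<not> E a b" if "a \<in> insert x S" "b \<in> insert x S" for a b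
        proof -
          have "\<not> E x u" "\<not> E u x" if "u \<in> S" for u
            using that * by (auto dest: E_sym)
          then show ?thesis using that S(2) E_irrefl by auto
        qed
        from max[OF sub this] False finS show False by simp
      qed
      then obtain s where s: "s \<in> S" "E x s" by blast
      show ?thesis
      proof (cases "\<exists>t\<in>S. E x t \<and> t \<noteq> s")
        case True
        then obtain t where "t \<in> S" "E x t" "t \<noteq> s" by blast
        then have "x \<in> C (s,t)" using s x by (simp add: C_def)
        then show ?thesis using s \<open>t \<in> S\<close> by blast
      next
        case False
        then have "\<forall>u\<in>S. E x u \<longleftrightarrow> u = s" using s by blast
        then have "x \<in> C (s,s)" using x by (simp add: C_def)
        then show ?thesis using s by blast
      qed
    qed
  qed
  then have "card W \<le> card (\<Union>p\<in>S \<times> S. C p)"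
    using finS finite_subset[OF C_sub finW] by (intro card_mono finite_UN_I) auto
  also have "\<dots> \<le> (\<Sum>p\<in>S \<times> S. card (C p))" using finS by (intro card_UN_le) auto
  also have "\<dots> \<le> (\<Sum>p\<in>S \<times> S. m)" using cC by (rule sum_mono)
  also have "\<dots> = (card S)\<^sup>2 * m" by (simp add: card_cartesian_product power2_eq_square)
  finally show ?thesis .
qed

text \<open>Take a largest clique \<open>Q\<close> and an independent set \<open>S\<close> that is
  largest among those of size at most \<open>2 * k\<close>. If \<open>S\<close> reaches size
  \<open>2 * k\<close>, the counting argument applies; otherwise no independent set has one element
  more, and the covering argument gives at most \<open>(2 * k)^2\<close> cliques.\<close>

lemma large_clique:
  assumes W: "W \<subseteq> V" and k: "k > 0"
    and deg: "\<And>v. v \<in> W \<Longrightarrow> card W \<le> k * card {x\<in>W. E x v}"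
  obtains Q where "Q \<subseteq> W" "clique_set E Q" "card W \<le> 4 * k\<^sup>2 * card Q"
proof -
  have finW: "finite W" using W finite_sub by auto
  define indep where "indep S \<longleftrightarrow> S \<subseteq> W \<and> (\<forall>x\<in>S. \<forall>y\<in>S. \<not> E x y)" for S
  have "clique_set E {}" by (simp add: clique_set_def)
  have "\<exists>Q. (Q \<subseteq> W \<and> clique_set E Q) \<and> (\<forall>R. R \<subseteq> W \<and> clique_set E R \<longrightarrow> card R \<le> card Q)"
  proof (rule ex_has_greatest_nat)
    show "{} \<subseteq> W \<and> clique_set E {}" using \<open>clique_set E {}\<close> by simp
    show "\<forall>R. R \<subseteq> W \<and> clique_set E R \<longrightarrow> card R < Suc (card W)"
      using card_mono[OF finW] by (simp add: less_Suc_eq_le)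
  qed
  then obtain Q where Q: "Q \<subseteq> W" "clique_set E Q"
    and Qmax: "\<And>R. R \<subseteq> W \<Longrightarrow> clique_set E R \<Longrightarrow> card R \<le> card Q" by blast
  have "\<exists>S. (indep S \<and> card S \<le> 2 * k) \<and> (\<forall>T. indep T \<and> card T \<le> 2 * k \<longrightarrow> card T \<le> card S)"
  proof (rule ex_has_greatest_nat)
    show "indep {} \<and> card ({} :: nat set) \<le> 2 * k" by (simp add: indep_def)
    show "\<forall>T. indep T \<and> card T \<le> 2 * k \<longrightarrow> card T < Suc (2 * k)" by simp
  qed
  then obtain S where S: "indep S" "card S \<le> 2 * k"
    and Smax: "\<And>T. indep T \<Longrightarrow> card T \<le> 2 * k \<Longrightarrow> card T \<le> card S" by blast
  have "card W \<le> 4 * k\<^sup>2 * card Q"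
  proof (cases "card S = 2 * k")
    case True
    then have "card W \<le> 2 * k\<^sup>2 * card Q"
      using S W k deg Qmax by (intro large_clique_of_independent[of W S]) (auto simp: indep_def)
    then show ?thesis by simp
  next
    case False
    then have "card W \<le> (card S)\<^sup>2 * card Q"
    proof (intro large_clique_of_max_independent[OF W])
      show "card T \<noteq> Suc (card S)" if "T \<subseteq> W" "\<And>x y. x \<in> T \<Longrightarrow> y \<in> T \<Longrightarrow> \<not> E x y" for T
      proof -
        have "indep T" using that by (simp add: indep_def)
        then show ?thesis using Smax[of T] False S(2) by linarith
      qed
    qed (use S(1) Qmax in \<open>auto simp: indep_def\<close>)
    also have "(card S)\<^sup>2 \<le> (2 * k)\<^sup>2" using S(2) by (rule power_mono) simp
    finally show ?thesis by (simp add: power_mult_distrib mult_right_mono)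
  qed
  then show thesis using that Q by blast
qed

section \<open>The recursion for Betti numbers\<close>

text \<open>The threshold \<open>n\<close> stays fixed while \<open>W\<close> shrinks. A vertex of
  degree below \<open>n / k\<close> costs \<open>P0\<close>; if there is none, a clique of size at
  least \<open>n / (4 * k^3)\<close> is removed at cost \<open>P1\<close>.\<close>

lemma red_betti_peel:
  assumes k: "k > 0" and n: "n > 0"
    and P0: "\<And>W. W \<subseteq> V \<Longrightarrow> k * card W < n \<Longrightarrow> red_betti (K :: 'k::field itself) W E j \<le> P0"
    and P1: "\<And>W. W \<subseteq> V \<Longrightarrow> card W \<le> n \<Longrightarrow> red_betti K W E j \<le> P1"
    and W: "W \<subseteq> V" "card W \<le> n"
  shows "red_betti K W E (Suc j) \<le> n * P0 + 4 * k^3 * P1"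
proof -
  \<comment> \<open>Amortised form: every removed vertex pays \<open>n * P0 + 4 * k^3 * P1\<close>.
    A single vertex covers its cost \<open>n * P0\<close>, a clique its cost
    \<open>n * P1\<close>.\<close>
  have "n * red_betti K W E (Suc j) \<le> card W * (n * P0 + 4 * k^3 * P1)"
    using W
  proof (induction "card W" arbitrary: W rule: less_induct)
    case less
    have finW: "finite W" using less.prems finite_sub by auto
    show ?case
    proof (cases "W = {}")
      case True
      then show ?thesis using red_betti_large[of W "Suc j" K E] by simp
    next
      case ne: False
      show ?thesis
      proof (cases "\<exists>v\<in>W. k * card {x\<in>W. E x v} < n")
        case True
        then obtain v where v: "v \<in> W" "k * card {x\<in>W. E x v} < n" by blast
        have c: "card W = Suc (card (W - {v}))" using card_Suc_Diff1[OF finW v(1)] by simp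
        have "red_betti K W E (Suc j) \<le> red_betti K (W - {v}) E (Suc j) + P0"
        proof -
          have "{x\<in>W. E x v} \<subseteq> V" using less.prems(1) by auto
          then have "red_betti K {x\<in>W. E x v} E j \<le> P0" using P0 v(2) by blast
          then show ?thesis using red_betti_remove_vertex[OF less.prems(1) v(1), of K j] by linarith
        qed
        then have "n * red_betti K W E (Suc j) \<le> n * red_betti K (W - {v}) E (Suc j) + n * P0"
          by (metis add_mult_distrib2 mult_le_mono2)
        moreover have "n * red_betti K (W - {v}) E (Suc j) \<le> card (W - {v}) * (n * P0 + 4 * k^3 * P1)"
          using less.prems c by (intro less.hyps) auto
        ultimately show ?thesis using c by simp
      next
        case False
        then have deg: "n \<le> k * card {x\<in>W. E x v}" if "v \<in> W" for v using that by force
        obtain Q where Q: "Q \<subseteq> W" "clique_set E Q" "card W \<le> 4 * k\<^sup>2 * card Q"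
          using large_clique[OF less.prems(1) k] deg le_trans[OF less.prems(2)] by metis
        have finQ: "finite Q" using Q finW finite_subset by auto
        have "card W > 0" using ne finW by (simp add: card_gt_0_iff)
        then have "Q \<noteq> {}" "card Q > 0" using Q(3) finQ by (auto simp: card_gt_0_iff)
        \<comment> \<open>A vertex of degree at least \<open>n / k\<close> forces
          \<open>card W \<ge> n / k\<close>; this turns the clique bound relative to
          \<open>card W\<close> into one relative to \<open>n\<close>.\<close>
        obtain v where "v \<in> W" using ne by auto
        then have "n \<le> k * card {x\<in>W. E x v}" using deg by blast
        also have "\<dots> \<le> k * card W" using finW by (intro mult_left_mono card_mono) auto
        also have "\<dots> \<le> k * (4 * k\<^sup>2 * card Q)" using Q(3) by simp
        finally have nQ: "n \<le> card Q * (4 * k^3)"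
          by (simp add: power2_eq_square power3_eq_cube algebra_simps)
        have c: "card W = card Q + card (W - Q)"
          using Q(1) finW finQ card_mono[OF finW Q(1)] by (simp add: card_Diff_subset)
        have "nbhd E W Q \<subseteq> W" by (auto simp: nbhd_def)
        then have "card (nbhd E W Q) \<le> card W" "nbhd E W Q \<subseteq> V"
          using card_mono[OF finW] less.prems(1) by (blast intro: subset_trans)+
        then have "red_betti K (nbhd E W Q) E j \<le> P1" using P1 less.prems(2) by simp
        then have "red_betti K W E (Suc j) \<le> red_betti K (W - Q) E (Suc j) + P1"
          using red_betti_remove_clique[OF less.prems(1) Q(1,2) \<open>Q \<noteq> {}\<close>, of K j] by linarith
        then have "n * red_betti K W E (Suc j) \<le> n * red_betti K (W - Q) E (Suc j) + n * P1"
          by (metis add_mult_distrib2 mult_le_mono2)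
        moreover have "n * red_betti K (W - Q) E (Suc j) \<le> card (W - Q) * (n * P0 + 4 * k^3 * P1)"
          using less.prems c \<open>card Q > 0\<close> by (intro less.hyps) auto
        moreover have "n * P1 \<le> card Q * (n * P0 + 4 * k^3 * P1)"
        proof -
          have "n * P1 \<le> card Q * (4 * k^3) * P1" using nQ by (rule mult_le_mono1)
          also have "\<dots> \<le> card Q * (n * P0 + 4 * k^3 * P1)" by (simp only: distrib_left mult.assoc)
          finally show ?thesis .
        qed
        ultimately show ?thesis unfolding c add_mult_distrib by linarith
      qed
    qed
  qed
  also have "\<dots> \<le> n * (n * P0 + 4 * k^3 * P1)" using W(2) by simp
  finally show ?thesis using n by simp
qed

text \<open>Both branches of the recursion lower \<open>j\<close>; the branch to small
  neighbourhoods also divides the size by \<open>k\<close> and so lowers \<open>a\<close>, which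
  pays for its factor \<open>N\<close>. That branch is at most the other one, so adding both
  replaces \<open>4 * k^3\<close> by \<open>8 * k^3\<close>.\<close>

lemma red_betti_bound:
  assumes k: "k > 0" and N: "N > 0" and W: "W \<subseteq> V" "card W \<le> N" "card W < k ^ a"
  shows "red_betti (K :: 'k::field itself) W E j \<le> N ^ a * (8 * k^3) ^ j"
  using W
proof (induction j arbitrary: W a)
  case 0
  have "1 \<le> N ^ a" using N by simp
  then show ?case using red_betti_0_le_1[of W K E] 0 finite_sub[of W] by (simp add: le_trans[of _ "Suc 0"])
next
  case (Suc j)
  show ?case
  proof (cases "card W = 0")
    case True
    then show ?thesis using red_betti_large[of W "Suc j" K E] finite_sub Suc.prems by simp
  next
    case False
    then obtain b where a: "a = Suc b" using Suc.prems by (cases a) auto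
    let ?n = "card W" and ?X = "(8 * k^3) ^ j"
    have "red_betti K W E (Suc j) \<le> ?n * (N ^ b * ?X) + 4 * k^3 * (N ^ a * ?X)"
    proof (rule red_betti_peel[OF k])
      show "0 < ?n" using False by simp
      show "red_betti K W' E j \<le> N ^ b * ?X" if "W' \<subseteq> V" "k * card W' < ?n" for W'
      proof (rule Suc.IH[OF that(1)])
        have "card W' \<le> k * card W'" using k by simp
        then show "card W' \<le> N" using that Suc.prems by linarith
        have "k * card W' < k * k ^ b" using that(2) Suc.prems(3) unfolding a power_Suc by linarith
        then show "card W' < k ^ b" using k by simp
      qed
      show "red_betti K W' E j \<le> N ^ a * ?X" if "W' \<subseteq> V" "card W' \<le> ?n" for W'
        using Suc.IH[OF that(1)] that Suc.prems by auto
    qed (use Suc.prems in auto)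
    also have "?n * (N ^ b * ?X) \<le> N * (N ^ b * ?X)" using Suc.prems by simp
    also have "\<dots> = 1 * (N ^ a * ?X)" using a by simp
    also have "\<dots> \<le> 4 * k^3 * (N ^ a * ?X)" using k by (intro mult_right_mono) auto
    finally show ?thesis by (simp add: algebra_simps)
  qed
qed

end

section \<open>The quasipolynomial upper bound\<close>

lemma ln_three_halves_ge: "ln (3/2 :: real) \<ge> 1/3"
proof -
  have "ln (2/3 :: real) \<le> 2/3 - 1" by (rule ln_le_minus_one) simp
  moreover have "ln (3/2 :: real) = - ln (2/3)" by (simp add: ln_div)
  ultimately show ?thesis by simp
qed

text \<open>With \<open>s = sqrt L\<close>, a factor \<open>k\<close> of about \<open>exp s\<close>
  must be taken out about \<open>s\<close> times to exhaust \<open>n = exp (s * s)\<close>. Then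
  \<open>n ^ a\<close> and \<open>(8 * k^3) ^ J\<close> both have exponents of order
  \<open>s * L\<close>. \<open>J\<close> exceeds every \<open>i\<close> with
  \<open>(3/2)^i \<le> n\<close>.\<close>

lemma quasipolynomial_estimate:
  fixes n :: nat
  assumes n: "n \<ge> 3"
  defines "L \<equiv> ln (real n)"
  defines "k \<equiv> nat \<lceil>exp (sqrt L)\<rceil>" and "a \<equiv> nat \<lfloor>sqrt L\<rfloor> + 1" and "J \<equiv> nat \<lfloor>3 * L\<rfloor> + 1"
  shows "k > 0" "n < k ^ a"
    "real ((J + 1) * (n ^ a * (8 * k^3) ^ J)) \<le> exp (42 * sqrt L * L)"
proof -
  define s where "s = sqrt L"
  have "1 \<le> L"
  proof -
    have "3 \<le> real n" using n by simp
    then have "exp 1 \<le> real n" by (rule order_trans[OF exp_le])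
    then show ?thesis using n unfolding L_def by (subst ln_ge_iff) auto
  qed
  then have s1: "1 \<le> s" and sL: "s * s = L" by (auto simp: s_def)
  have expL: "exp L = real n" using n by (simp add: L_def)
  have k_ge: "exp s \<le> real k" unfolding k_def s_def by (rule real_nat_ceiling_ge)
  then show "k > 0" using exp_gt_zero[of s] by (metis gr0I of_nat_0 not_less)
  have e1: "1 \<le> exp s" using s1 by simp
  then have "real k \<le> exp s + 1" unfolding k_def s_def[symmetric] by linarith
  then have k_le: "real k \<le> 2 * exp s" using e1 by linarith
  have a_gt: "s < real a" and a_le: "real a \<le> s + 1" using s1 unfolding a_def s_def[symmetric] by linarith+
  have J_le: "real J \<le> 3 * L + 1" using \<open>1 \<le> L\<close> unfolding J_def by linarith
  have "real n = exp (s * s)" using expL sL by simp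
  also have "\<dots> < exp (real a * s)" using a_gt s1 by simp
  also have "\<dots> = exp s ^ a" by (rule exp_of_nat_mult)
  also have "\<dots> \<le> real k ^ a" using k_ge by (intro power_mono) auto
  finally have "real n < real (k ^ a)" by simp
  then show "n < k ^ a" by linarith
  have "real (n ^ a) = exp (real a * L)" using expL by (simp add: exp_of_nat_mult)
  also have "\<dots> \<le> exp ((s + 1) * L)" using a_le \<open>1 \<le> L\<close> by simp
  finally have 1: "real (n ^ a) \<le> exp ((s + 1) * L)" .
  \<comment> \<open>Prepares to absorb the factor \<open>8 * 2^3 = 64\<close> arising from
    \<open>k \<le> 2 * exp s\<close>.\<close>
  have "(2::real) \<le> exp 1" using exp_ge_add_one_self[of 1] by simp
  then have "(2::real) ^ 6 \<le> exp 1 ^ 6" by (rule power_mono) simp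
  also have "exp 1 ^ 6 = exp (6::real)" using exp_of_nat_mult[of 6 "1::real"] by simp
  finally have e6: "64 \<le> exp (6::real)" by simp
  have "real (8 * k^3) \<le> 8 * (2 * exp s) ^ 3" using power_mono[OF k_le, of 3] by simp
  also have "\<dots> = 64 * exp (3 * s)" using exp_of_nat_mult[of 3 s] by (simp add: power_mult_distrib)
  also have "\<dots> \<le> exp 6 * exp (3 * s)" using e6 by simp
  also have "\<dots> = exp (6 + 3 * s)" by (simp add: exp_add)
  finally have "real ((8 * k^3) ^ J) \<le> exp (6 + 3 * s) ^ J"
    unfolding of_nat_power by (rule power_mono) simp
  also have "\<dots> = exp (real J * (6 + 3 * s))" by (rule exp_of_nat_mult[symmetric])
  also have "\<dots> \<le> exp ((3 * L + 1) * (6 + 3 * s))" using J_le s1 by simp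
  finally have 2: "real ((8 * k^3) ^ J) \<le> exp ((3 * L + 1) * (6 + 3 * s))" .
  have "real (J + 1) \<le> exp (real J)" using exp_ge_add_one_self[of "real J"] by simp
  also have "\<dots> \<le> exp (3 * L + 1)" using J_le by simp
  finally have 3: "real (J + 1) \<le> exp (3 * L + 1)" .
  have "real ((J + 1) * (n ^ a * (8 * k^3) ^ J))
      \<le> exp (3 * L + 1) * (exp ((s + 1) * L) * exp ((3 * L + 1) * (6 + 3 * s)))"
    unfolding of_nat_mult using 1 2 3 by (intro mult_mono) simp_all
  also have "\<dots> = exp ((3 * L + 1) + ((s + 1) * L + (3 * L + 1) * (6 + 3 * s)))"
    by (simp only: exp_add)
  also have "(3 * L + 1) + ((s + 1) * L + (3 * L + 1) * (6 + 3 * s)) \<le> 42 * s * L"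
  proof -
    have L: "L \<le> s * L" using s1 \<open>1 \<le> L\<close> by (simp add: mult_left_mono[of 1 s L, simplified])
    \<comment> \<open>As \<open>s\<close> and \<open>L\<close> are at least 1, the three summands
      are at most 4, 2 and 36 times \<open>s * L\<close>, which add up to 42.\<close>
    have "(3 * L + 1) * (6 + 3 * s) \<le> (4 * L) * (9 * s)"
      using s1 \<open>1 \<le> L\<close> by (intro mult_mono) auto
    moreover have "(s + 1) * L = s * L + L" by (simp add: algebra_simps)
    moreover have "(4 * L) * (9 * s) = 36 * (s * L)" by simp
    ultimately show ?thesis using L \<open>1 \<le> L\<close> by linarith
  qed
  then have "exp ((3 * L + 1) + ((s + 1) * L + (3 * L + 1) * (6 + 3 * s))) \<le> exp (42 * s * L)" by simp
  finally show "real ((J + 1) * (n ^ a * (8 * k^3) ^ J)) \<le> exp (42 * sqrt L * L)"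
    by (simp add: s_def)
qed

lemma (in C4_free_graph) total_red_betti_bound:
  assumes n: "n \<ge> 3" and V: "card V \<le> n"
  shows "real (total_red_betti (K :: 'k::field itself) V E) \<le> exp (42 * sqrt (ln (real n)) * ln (real n))"
proof -
  define L where "L = ln (real n)"
  define k where "k = nat \<lceil>exp (sqrt L)\<rceil>"
  define a where "a = nat \<lfloor>sqrt L\<rfloor> + 1"
  define J where "J = nat \<lfloor>3 * L\<rfloor> + 1"
  note est = quasipolynomial_estimate[OF n, folded L_def, folded k_def a_def J_def]
  let ?X = "n ^ a * (8 * k^3) ^ J"
  \<comment> \<open>For \<open>j = Suc i\<close> nonzero homology needs
    \<open>(3/2)^i \<le> n\<close>, hence \<open>i \<le> 3 * L\<close> because
    \<open>ln (3/2) \<ge> 1/3\<close>.\<close>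
  have vanish: "red_betti K V E j = 0" if jJ: "j > J" for j
  proof (rule ccontr)
    assume nz: "red_betti K V E j \<noteq> 0"
    obtain i where i: "j = Suc i" using jJ by (cases j) auto
    have "(3/2) ^ i \<le> real (card V)"
      using red_betti_nonzero_imp_card_ge[OF order_refl, of K i] nz i by simp
    also have "\<dots> \<le> real n" using V by simp
    finally have "ln ((3/2) ^ i) \<le> ln (real n)" using n by (subst ln_le_cancel_iff) auto
    then have "real i * ln (3/2) \<le> L" by (simp add: ln_realpow L_def)
    moreover have "real i * (1/3) \<le> real i * ln (3/2)"
      using ln_three_halves_ge by (intro mult_left_mono) auto
    ultimately have "real i \<le> 3 * L" by linarith
    then have "i \<le> nat \<lfloor>3 * L\<rfloor>" by linarith
    then show False using jJ i by (simp add: J_def)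
  qed
  have bound: "red_betti K V E j \<le> ?X" if "j \<le> J" for j
  proof -
    have "red_betti K V E j \<le> n ^ a * (8 * k^3) ^ j"
      using red_betti_bound[OF est(1) _ order_refl V, of a K j] est(2) V n by simp
    also have "\<dots> \<le> ?X" using that est(1) by (intro mult_left_mono power_increasing) auto
    finally show ?thesis .
  qed
  have "total_red_betti K V E \<le> (\<Sum>j\<in>{0..card V + 1}. if j \<le> J then ?X else 0)"
    unfolding total_red_betti_def using vanish bound by (intro sum_mono) auto
  also have "\<dots> = (\<Sum>j\<in>{0..card V + 1} \<inter> {j. j \<le> J}. ?X)"
    by (subst sum.inter_restrict) (auto intro: sum.cong)
  also have "\<dots> = card ({0..card V + 1} \<inter> {j. j \<le> J}) * ?X" by simp
  also have "\<dots> \<le> card {..J} * ?X"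
    by (intro mult_right_mono card_mono) auto
  finally have "total_red_betti K V E \<le> (J + 1) * ?X" by simp
  then show ?thesis using est(3) unfolding L_def by (meson le_trans of_nat_mono order_trans)
qed

lemma C4_free_graphI:
  assumes "simple_graph_on {0..<m} E" "induced_C4_free {0..<m} E"
  shows "C4_free_graph {0..<m} E"
  using assms by unfold_locales (auto simp: simple_graph_on_def)

lemma b_C4_set_bounded:
  assumes "n \<ge> 3" "x \<in> {total_red_betti (K :: 'k::field itself) {0..<m} E | m E.
      m \<le> n \<and> simple_graph_on {0..<m} E \<and> induced_C4_free {0..<m} E}"
  shows "real x \<le> exp (42 * sqrt (ln (real n)) * ln (real n))"
  using assms C4_free_graph.total_red_betti_bound[OF C4_free_graphI] by force

text \<open>\<open>Max\<close> is meaningful for finite sets only; finiteness is read off from the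
  upper bound on all members.\<close>

lemma b_C4_set_finite:
  assumes "n \<ge> 3"
  shows "finite {total_red_betti (K :: 'k::field itself) {0..<m} E | m E.
      m \<le> n \<and> simple_graph_on {0..<m} E \<and> induced_C4_free {0..<m} E}" (is "finite ?S")
proof (rule finite_subset)
  show "?S \<subseteq> {..nat \<lfloor>exp (42 * sqrt (ln (real n)) * ln (real n))\<rfloor>}"
    using b_C4_set_bounded[OF assms, of _ K] by (meson atMost_iff le_nat_floor subsetI)
qed simp

lemma b_C4_upper:
  assumes n: "n \<ge> 3"
  shows "real (b_C4 (K :: 'k::field itself) n) \<le> exp (42 * sqrt (ln (real n)) * ln (real n))"
proof -
  \<comment> \<open>The empty graph shows that the maximum is over a nonempty set.\<close>
  have "total_red_betti K {0..<0} (\<lambda>x y. False) \<in> {total_red_betti K {0..<m} E | m E.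
      m \<le> n \<and> simple_graph_on {0..<m} E \<and> induced_C4_free {0..<m} E}"
    by (force simp: simple_graph_on_def induced_C4_free_def)
  then have "b_C4 K n \<in> {total_red_betti K {0..<m} E | m E.
      m \<le> n \<and> simple_graph_on {0..<m} E \<and> induced_C4_free {0..<m} E}"
    unfolding b_C4_def using b_C4_set_finite[OF n, of K] by (intro Max_in) auto
  then show ?thesis by (rule b_C4_set_bounded[OF n])
qed

section \<open>The lower bound\<close>

lemma face_chain_inj: "inj (face_chain :: nat set \<Rightarrow> nat set \<Rightarrow> 'k::field)"
proof (rule injI)
  fix \<sigma> \<tau> assume "(face_chain \<sigma> :: nat set \<Rightarrow> 'k) = face_chain \<tau>"
  then have "(face_chain \<sigma> \<sigma> :: 'k) = face_chain \<tau> \<sigma>" by simp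
  then show "\<sigma> = \<tau>" by (simp add: face_chain_def split: if_splits)
qed

lemma face_chain_independent: "fs.independent (face_chain ` S :: (nat set \<Rightarrow> 'k::field) set)"
  unfolding fs.dependent_def
proof
  assume "\<exists>a\<in>face_chain ` S. a \<in> fs.span (face_chain ` S - {a :: nat set \<Rightarrow> 'k})"
  then obtain \<sigma> where \<sigma>: "(face_chain \<sigma> :: nat set \<Rightarrow> 'k) \<in> fs.span (face_chain ` S - {face_chain \<sigma>})"
    by blast
  have "fs.subspace {f :: nat set \<Rightarrow> 'k. f \<sigma> = 0}" by (simp add: fs.subspace_def)
  moreover have "face_chain ` S - {face_chain \<sigma>} \<subseteq> {f :: nat set \<Rightarrow> 'k. f \<sigma> = 0}"
    by (auto simp: face_chain_def)
  ultimately have "(face_chain \<sigma> :: nat set \<Rightarrow> 'k) \<in> {f. f \<sigma> = 0}"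
    using \<sigma> fs.span_minimal by blast
  then show False by (simp add: face_chain_def)
qed

lemma card_cliques_le_dim_chains:
  assumes "finite W"
  shows "card (cliques W E j) \<le> fs.dim (chains W E j :: (nat set \<Rightarrow> 'k::field) set)"
proof -
  let ?F = "face_chain ` cliques W E j :: (nat set \<Rightarrow> 'k) set"
  have "?F \<subseteq> chains W E j" by (auto simp: chains_def face_chain_def)
  then have "fs.dim (chains W E j :: (nat set \<Rightarrow> 'k) set) = card ?F"
    by (rule fs.dim_unique[OF _ chains_subset_span[OF assms] face_chain_independent refl])
  also have "\<dots> = card (cliques W E j)" by (intro card_image inj_on_subset[OF face_chain_inj]) auto
  finally show ?thesis by simp
qed

text \<open>In top dimension all boundaries are zero, so the Betti number is the dimension of the
  cycles, which rank-nullity bounds from below. For \<open>j = 1\<close> this is the number of edges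
  minus the number of vertices.\<close>

lemma red_betti_top_lower:
  assumes W: "finite W" and top: "cliques W E (Suc (Suc j)) = {}"
  shows "card (cliques W E (Suc j)) \<le> red_betti (K :: 'k::field itself) W E (Suc j) + card (cliques W E j)"
proof -
  have "chains W E (Suc (Suc j)) = {0 :: nat set \<Rightarrow> 'k}" using top by (auto simp: chains_def)
  then have "boundaries W E (Suc j) = {0 :: nat set \<Rightarrow> 'k}" by (simp add: boundaries_def)
  then have "fs.dim (boundaries W E (Suc j) :: (nat set \<Rightarrow> 'k) set) = 0"
    using fs.dim_le_card[of "{0 :: nat set \<Rightarrow> 'k}" "{}"] by simp
  then have betti: "red_betti K W E (Suc j) = fs.dim (cycles W E (Suc j) :: (nat set \<Rightarrow> 'k) set)"
    by (simp add: red_betti_eq[OF W])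
  let ?C = "chains W E (Suc j) :: (nat set \<Rightarrow> 'k) set"
  let ?F = "face_chain ` cliques W E j :: (nat set \<Rightarrow> 'k) set"
  have fin: "finite ?F" using cliques_finite[OF W] by simp
  have "bnd W ` ?C \<subseteq> chains W E j" using bnd_chains by blast
  then have "bnd W ` ?C \<subseteq> fs.span ({} \<union> ?F)" using chains_subset_span[OF W] by simp (rule subset_trans)
  then obtain F' where F': "F' \<subseteq> bnd W ` ?C" "finite F'" "card F' \<le> card ?F" "bnd W ` ?C \<subseteq> fs.span ({} \<union> F')"
    using fs.spanning_modulo_subset[of "{}" "{}" ?F] fin by (metis empty_subsetI finite.emptyI)
  \<comment> \<open>\<open>T\<close> lifts generators of the image of the boundary map, so every
    chain is a cycle plus a combination of \<open>T\<close>.\<close>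
  obtain T where T: "T \<subseteq> ?C" "finite T" "card T = card F'" "bnd W ` T = F'"
    using F'(1,2) by (metis subset_image_inj card_image finite_imageD)
  have "fs.subspace (bnd W ` fs.span T)"
    unfolding fs.subspace_def
  proof (intro conjI ballI allI)
    show "0 \<in> bnd W ` fs.span T" using fs.span_zero bnd_0 by (metis image_eqI)
    show "x + y \<in> bnd W ` fs.span T" if xy: "x \<in> bnd W ` fs.span T" "y \<in> bnd W ` fs.span T" for x y
    proof -
      obtain t t' where "x = bnd W t" "t \<in> fs.span T" "y = bnd W t'" "t' \<in> fs.span T" using xy by blast
      then have "x + y = bnd W (t + t')" "t + t' \<in> fs.span T" by (simp_all only: bnd_add fs.span_add)
      then show ?thesis by blast
    qed
    show "(\<lambda>u. c * x u) \<in> bnd W ` fs.span T" if x: "x \<in> bnd W ` fs.span T" for c x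
    proof -
      obtain t where "x = bnd W t" "t \<in> fs.span T" using x by blast
      then have "(\<lambda>u. c * x u) = bnd W (\<lambda>u. c * t u)" "(\<lambda>u. c * t u) \<in> fs.span T"
        by (simp_all only: bnd_scale fs.span_scale)
      then show ?thesis by blast
    qed
  qed
  then have "fs.span F' \<subseteq> bnd W ` fs.span T"
    using T(4) fs.span_superset[of T] by (intro fs.span_minimal) auto
  then have im: "bnd W ` ?C \<subseteq> bnd W ` fs.span T" using F'(4) by simp
  have "?C \<subseteq> fs.span (cycles W E (Suc j) \<union> T)"
  proof
    fix f assume f: "f \<in> ?C"
    then obtain t where t: "t \<in> fs.span T" "bnd W f = bnd W t" using im by blast
    have "t \<in> ?C" using t(1) fs.span_minimal[OF T(1) chains_subspace] by blast
    then have "f - t \<in> ?C" using f fs.subspace_diff[OF chains_subspace] by blast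
    moreover have "bnd W (f - t) = 0" using t(2) by (simp add: bnd_diff del: minus_apply)
    ultimately have "f - t \<in> cycles W E (Suc j)" by (simp add: cycles_def)
    then have "f - t \<in> fs.span (cycles W E (Suc j) \<union> T)" by (intro fs.span_base) simp
    moreover have "t \<in> fs.span (cycles W E (Suc j) \<union> T)" using t(1) fs.span_mono[of T] by blast
    ultimately have "(f - t) + t \<in> fs.span (cycles W E (Suc j) \<union> T)" by (rule fs.span_add)
    then show "f \<in> fs.span (cycles W E (Suc j) \<union> T)" by simp
  qed
  then have "fs.dim ?C \<le> fs.dim (cycles W E (Suc j) :: (nat set \<Rightarrow> 'k) set) + card T"
    using cycles_subset_span[OF W] cliques_finite[OF W] T(2)
    by (intro fs.dim_le_dim_plus_card[of "face_chain ` cliques W E (Suc j)"]) auto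
  moreover have "card T \<le> card (cliques W E j)"
    using T(3) F'(3) card_image_le[OF cliques_finite[OF W], of face_chain E j] by (metis order_trans)
  ultimately show ?thesis
    using betti card_cliques_le_dim_chains[OF W, where ?'k='k, of E "Suc j"] by linarith
qed

text \<open>The incidence graph of \<open>I\<close>: left vertices keep their number, right vertices
  are shifted by \<open>N\<close>.\<close>

definition bipartite_edges :: "nat \<Rightarrow> (nat \<times> nat) set \<Rightarrow> nat \<Rightarrow> nat \<Rightarrow> bool" where
  "bipartite_edges N I u v \<longleftrightarrow> (u < N \<and> N \<le> v \<and> (u, v - N) \<in> I) \<or> (v < N \<and> N \<le> u \<and> (v, u - N) \<in> I)"

text \<open>The graph is bipartite, so it has no triangle, and \<open>K22\<close> excludes every
  4-cycle. Its clique complex is one-dimensional, with at least \<open>card I\<close> edges and at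
  most \<open>2 * N\<close> vertices.\<close>

lemma bipartite_b_C4_lower:
  assumes n: "2 * N \<le> n" "n \<ge> 3" "N > 0" and I: "I \<subseteq> {0..<N} \<times> {0..<N}"
    and K22: "\<And>a b c d. (a,b) \<in> I \<Longrightarrow> (c,b) \<in> I \<Longrightarrow> (a,d) \<in> I \<Longrightarrow> (c,d) \<in> I \<Longrightarrow> a = c \<or> b = d"
  shows "card I \<le> b_C4 (K :: 'k::field itself) n + 2 * N"
proof -
  let ?V = "{0..<2 * N}" and ?E = "bipartite_edges N I"
  have simple: "simple_graph_on ?V ?E"
    using I by (fastforce simp: simple_graph_on_def bipartite_edges_def)
  have left: "N \<le> v \<and> (u, v - N) \<in> I" if "?E u v" "u < N" for u v
    using that by (auto simp: bipartite_edges_def)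
  have right: "v < N \<and> (v, u - N) \<in> I" if "?E u v" "N \<le> u" for u v
    using that by (auto simp: bipartite_edges_def)
  have C4: "induced_C4_free ?V ?E"
    unfolding induced_C4_free_def
  proof (clarify)
    fix a b c d assume *: "distinct [a,b,c,d]" "?E a b" "?E b c" "?E c d" "?E d a"
    show False
    proof (cases "a < N")
      case True
      have b: "N \<le> b" "(a, b - N) \<in> I" using left[OF *(2) True] by auto
      have c: "c < N" "(c, b - N) \<in> I" using right[OF *(3) b(1)] by auto
      have d: "N \<le> d" "(c, d - N) \<in> I" using left[OF *(4) c(1)] by auto
      have "(a, d - N) \<in> I" using right[OF *(5) d(1)] by auto
      then show False using K22[OF b(2) c(2) _ d(2)] *(1) b(1) d(1) by auto
    next
      case False
      then have a: "N \<le> a" by simp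
      have b: "b < N" "(b, a - N) \<in> I" using right[OF *(2) a] by auto
      have c: "N \<le> c" "(b, c - N) \<in> I" using left[OF *(3) b(1)] by auto
      have d: "d < N" "(d, c - N) \<in> I" using right[OF *(4) c(1)] by auto
      have "(d, a - N) \<in> I" using left[OF *(5) d(1)] by auto
      then show False using K22[OF b(2) _ c(2) d(2)] *(1) a c(1) by auto
    qed
  qed
  have "cliques ?V ?E (Suc (Suc 1)) = {}"
  proof (rule ccontr)
    assume "cliques ?V ?E (Suc (Suc 1)) \<noteq> {}"
    then obtain \<sigma> where \<sigma>: "card \<sigma> = 3" "\<And>x y. x \<in> \<sigma> \<Longrightarrow> y \<in> \<sigma> \<Longrightarrow> x \<noteq> y \<Longrightarrow> ?E x y"
      by (auto simp: cliques_def numeral_3_eq_3)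
    obtain x y z where "\<sigma> = {x,y,z}" "x \<noteq> y" "x \<noteq> z" "y \<noteq> z" using \<sigma>(1) by (auto simp: card_3_iff)
    then have "?E x y" "?E y z" "?E x z" using \<sigma>(2) by auto
    then show False by (auto simp: bipartite_edges_def)
  qed
  from red_betti_top_lower[OF _ this, of K]
  have "card (cliques ?V ?E 2) \<le> red_betti K ?V ?E 2 + card (cliques ?V ?E 1)"
    by (simp add: numeral_2_eq_2)
  moreover have "card (cliques ?V ?E 1) \<le> 2 * N"
  proof -
    have "cliques ?V ?E 1 \<subseteq> (\<lambda>x. {x}) ` ?V" by (auto simp: cliques_def card_1_singleton_iff)
    then have "card (cliques ?V ?E 1) \<le> card ((\<lambda>x. {x}) ` ?V)" by (intro card_mono) auto
    also have "\<dots> \<le> card ?V" by (rule card_image_le) simp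
    finally show ?thesis by simp
  qed
  moreover have "card I \<le> card (cliques ?V ?E 2)"
  proof (rule card_inj_on_le)
    have eq: "i < N" "j < N" if "(i,j) \<in> I" for i j using I that by auto
    show "inj_on (\<lambda>(i,j). {i, N + j}) I"
    proof (rule inj_onI, clarify)
      fix i j i' j' assume "(i,j) \<in> I" "(i',j') \<in> I" "{i, N + j} = {i', N + j'}"
      then show "i = i' \<and> j = j'" using eq[of i j] eq[of i' j'] by (auto simp: doubleton_eq_iff)
    qed
    show "(\<lambda>(i,j). {i, N + j}) ` I \<subseteq> cliques ?V ?E 2"
    proof (clarify)
      fix i j assume ij: "(i,j) \<in> I"
      then have "i \<noteq> N + j" "?E i (N + j)" "?E (N + j) i" using eq[OF ij] by (auto simp: bipartite_edges_def)
      then show "{i, N + j} \<in> cliques ?V ?E 2" using eq[OF ij] by (simp add: cliques_def)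
    qed
    show "finite (cliques ?V ?E 2)" by (rule cliques_finite) simp
  qed
  moreover have "red_betti K ?V ?E 2 \<le> total_red_betti K ?V ?E"
    unfolding total_red_betti_def by (rule member_le_sum) (use n in auto)
  moreover have "total_red_betti K ?V ?E \<le> b_C4 K n"
    unfolding b_C4_def using n simple C4 b_C4_set_finite[OF n(2), of K]
    by (intro Max_ge) auto
  ultimately show ?thesis by linarith
qed

section \<open>A finite field and its affine plane\<close>

text \<open>The polynomial \<open>X^q - X\<close> splits into linear factors, and its derivative is
  -1 in characteristic 2, so its \<open>q\<close> roots are distinct.\<close>

lemma card_fixed_points_frobenius:
  assumes char: "CHAR('a::alg_closed_field) = 2" and k: "k > 0"
  shows "card {x :: 'a. x ^ (2 ^ k) = x} = 2 ^ k"
proof -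
  define q :: nat where "q = 2 ^ k"
  define p :: "'a poly" where "p = Polynomial.monom 1 q - [:0, 1:]"
  have q1: "q > 1" using k one_less_power[of "2::nat" k] by (simp add: q_def)
  have poly_p: "poly p x = x ^ q - x" for x by (simp add: p_def poly_monom)
  have "degree p = q"
    unfolding p_def using q1 by (subst diff_conv_add_uminus, subst degree_add_eq_left) (auto simp: degree_monom_eq)
  then have "p \<noteq> 0" using q1 by auto
  have "coeff p q = 1" using q1 by (simp add: p_def coeff_pCons split: nat.split)
  then obtain A where A: "size A = q" "p = (\<Prod>x\<in>#A. [:-x, 1:])"
    using alg_closed_imp_factorization[OF \<open>p \<noteq> 0\<close>] \<open>degree p = q\<close> by auto
  have "of_nat q = (0 :: 'a)" using of_nat_eq_0_iff_char_dvd[where ?'a='a, of q] char k by (simp add: q_def)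
  then have deriv: "poly (pderiv p) x = -1" for x
    by (simp add: p_def pderiv_diff pderiv_monom pderiv_pCons)
  have "count A x \<le> 1" for x
  proof (rule ccontr)
    assume "\<not> count A x \<le> 1"
    \<comment> \<open>A double root would also be a root of the derivative.\<close>
    then have "{#x, x#} \<subseteq># A"
      by (auto simp: subseteq_mset_def)
    then obtain B where "A = {#x, x#} + B" by (metis subset_mset.add_diff_inverse)
    then have "p = [:-x, 1:] * ([:-x, 1:] * (\<Prod>y\<in>#B. [:-y, 1:]))" using A by simp
    then have "poly (pderiv p) x = 0" by (simp only: pderiv_mult) simp
    then show False using deriv by simp
  qed
  then have "A = mset_set (set_mset A)"
    by (intro multiset_eqI) (metis count_eq_zero_iff count_mset_set finite_set_mset le_neq_implies_less less_one)
  then have "card (set_mset A) = q" using A(1) by (metis size_mset_set)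
  moreover have "poly p x = 0 \<longleftrightarrow> x \<in># A" for x
    unfolding A(2) poly_prod_mset by (auto simp: prod_mset_zero_iff image_iff)
  then have "set_mset A = {x. x ^ q = x}" using poly_p by auto
  ultimately show ?thesis by (simp add: q_def)
qed

lemma CHAR_bit: "CHAR(bit) = 2"
proof (rule CHAR_eqI)
  show "2 dvd n" if "of_nat n = (0 :: bit)" for n :: nat
  proof (rule ccontr)
    assume "odd n"
    then obtain m where "n = 2 * m + 1" by (rule oddE)
    then show False using that by simp
  qed
qed simp

text \<open>Points \<open>(x, y)\<close> and lines \<open>y = m * x + b\<close> over the field
  \<open>F\<close> of \<open>q\<close> elements; two distinct lines share at most one point. Closure
  of \<open>F\<close> under sums uses additivity of the Frobenius map.\<close>

lemma affine_plane_incidences: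
  assumes k: "k > 0"
  defines "q \<equiv> (2::nat) ^ k"
  obtains I where "I \<subseteq> {0..<q\<^sup>2} \<times> {0..<q\<^sup>2}" "card I = q ^ 3"
    "\<And>a b c d. (a,b) \<in> I \<Longrightarrow> (c,b) \<in> I \<Longrightarrow> (a,d) \<in> I \<Longrightarrow> (c,d) \<in> I \<Longrightarrow> a = c \<or> b = d"
proof -
  define F :: "bit alg_closure set" where "F = {x. x ^ (2 ^ k) = x}"
  have char: "CHAR(bit alg_closure) = 2" by (simp add: CHAR_bit)
  have cardF: "card F = q" unfolding F_def q_def by (rule card_fixed_points_frobenius[OF char k])
  have "q > 0" by (simp add: q_def)
  then have finF: "finite F" using cardF card_gt_0_iff by force
  have "(x + y) ^ (2 ^ k) = x ^ (2 ^ k) + y ^ (2 ^ k)" for x y :: "bit alg_closure"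
    by (rule freshmans_dream'[of _ k]) (simp_all add: CHAR_bit)
  then have add: "x + y \<in> F" if "x \<in> F" "y \<in> F" for x y
    using that by (simp add: F_def)
  have mult: "x * y \<in> F" if "x \<in> F" "y \<in> F" for x y
    using that by (simp add: F_def power_mult_distrib)
  define P where "P = F \<times> F"
  have "finite P" "card P = q\<^sup>2"
    using finF by (auto simp: P_def card_cartesian_product cardF power2_eq_square)
  \<comment> \<open>Points and lines are both pairs over \<open>F\<close>, so one numbering serves
    for both.\<close>
  then obtain e where e: "bij_betw e P {0..<q\<^sup>2}"
    using ex_bij_betw_finite_nat by metis
  then have inj: "inj_on e P" by (simp add: bij_betw_def)
  define g where "g = inv_into P e"
  have ge: "g (e p) = p" if "p \<in> P" for p
    unfolding g_def using inj that by (rule inv_into_f_f)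
  \<comment> \<open>An incidence is determined by the line \<open>(m, b)\<close> and the abscissa
    \<open>x\<close> of the point, which gives \<open>q^3\<close> of them.\<close>
  define h where "h = (\<lambda>(x,m,b). (e (x, m * x + b), e (m, b)))"
  define I where "I = h ` (F \<times> F \<times> F)"
  have line: "snd (g i) = fst (g j) * fst (g i) + snd (g j) \<and> e (g i) = i \<and> e (g j) = j" if "(i,j) \<in> I" for i j
  proof -
    from that obtain x m b where xmb: "x \<in> F" "m \<in> F" "b \<in> F" "i = e (x, m * x + b)" "j = e (m, b)"
      by (auto simp: I_def h_def)
    then have "(x, m * x + b) \<in> P" "(m, b) \<in> P" using add mult by (auto simp: P_def)
    then show ?thesis using xmb ge by simp
  qed
  have "inj_on h (F \<times> F \<times> F)"
  proof (rule inj_onI)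
    fix u v assume uv: "u \<in> F \<times> F \<times> F" "v \<in> F \<times> F \<times> F" "h u = h v"
    obtain x m b x' m' b' where eqs: "u = (x, m, b)" "v = (x', m', b')" by (metis prod_cases3)
    have F: "x \<in> F" "m \<in> F" "b \<in> F" "x' \<in> F" "m' \<in> F" "b' \<in> F" using uv(1,2) eqs by auto
    have eq: "h (x, m, b) = h (x', m', b')" using uv(3) eqs by simp
    have P: "(x, m * x + b) \<in> P" "(m, b) \<in> P" "(x', m' * x' + b') \<in> P" "(m', b') \<in> P"
      using F add mult by (auto simp: P_def)
    have "h (x, m, b) = (e (x, m * x + b), e (m, b))" "h (x', m', b') = (e (x', m' * x' + b'), e (m', b'))"
      by (simp_all only: h_def prod.case)
    then have "e (x, m * x + b) = e (x', m' * x' + b')" "e (m, b) = e (m', b')"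
      using eq by (simp_all only: prod.inject)
    then have "(x, m * x + b) = (x', m' * x' + b')" "(m, b) = (m', b')"
      using inj_onD[OF inj _ P(1,3)] inj_onD[OF inj _ P(2,4)] by blast+
    then show "u = v" using eqs by simp
  qed
  then have cardI: "card I = q ^ 3"
    unfolding I_def by (simp add: card_image card_cartesian_product cardF power3_eq_cube)
  have I_sub: "I \<subseteq> {0..<q\<^sup>2} \<times> {0..<q\<^sup>2}"
  proof -
    have "e p \<in> {0..<q\<^sup>2}" if "p \<in> P" for p using e that by (rule bij_betwE[THEN bspec])
    moreover have "(x, m * x + b) \<in> P" "(m, b) \<in> P" if "x \<in> F" "m \<in> F" "b \<in> F" for x m b
      using that add mult by (simp_all add: P_def)
    ultimately have "h (x, m, b) \<in> {0..<q\<^sup>2} \<times> {0..<q\<^sup>2}" if "x \<in> F" "m \<in> F" "b \<in> F" for x m b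
      using that by (simp only: h_def prod.case mem_Times_iff fst_conv snd_conv)
    then show ?thesis unfolding I_def by (intro image_subsetI) (metis mem_Sigma_iff prod_cases3)
  qed
  have "a = c \<or> b = d" if I: "(a,b) \<in> I" "(c,b) \<in> I" "(a,d) \<in> I" "(c,d) \<in> I" for a b c d
  proof -
    define x x' m t m' t' where "x = fst (g a)" and "x' = fst (g c)"
      and "m = fst (g b)" and "t = snd (g b)" and "m' = fst (g d)" and "t' = snd (g d)"
    have 1: "snd (g a) = m * x + t" "snd (g c) = m * x' + t" "m * x + t = m' * x + t'" "m * x' + t = m' * x' + t'"
      using line[OF I(1)] line[OF I(2)] line[OF I(3)] line[OF I(4)]
      unfolding x_def x'_def m_def m'_def t_def t'_def by simp_all
    \<comment> \<open>Subtracting the incidence equations leaves a zero product: the slopes agree,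
      or the abscissas do.\<close>
    have "(m - m') * (x - x') = (m * x + t) - (m' * x + t') - ((m * x' + t) - (m' * x' + t'))"
      by (simp add: algebra_simps)
    also have "\<dots> = 0" using 1 by simp
    finally consider "m = m'" | "x = x'" by auto
    then show ?thesis
    proof cases
      case eq: 1
      then have "t = t'" using 1(3) by simp
      then have "g b = g d" using eq by (simp add: prod_eq_iff m_def m'_def t_def t'_def)
      then show ?thesis using line[OF I(1)] line[OF I(3)] by metis
    next
      case eq: 2
      then have "g a = g c" using 1(1,2) by (simp add: prod_eq_iff x_def x'_def)
      then show ?thesis using line[OF I(1)] line[OF I(2)] by metis
    qed
  qed
  then show thesis by (rule that[OF I_sub cardI])
qed

section \<open>Choice of the field size and conclusion\<close>

lemma b_C4_lower:
  assumes n: "n \<ge> 128"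
  shows "(1/8) powr (3/2) / 2 * real n powr (3/2) < real (b_C4 (K :: 'k::field itself) n)"
proof -
  have "1 \<le> n div 2" using n by linarith
  \<comment> \<open>\<open>4^k = q^2\<close> is the largest power of 4 with
    \<open>2 * q^2 \<le> n\<close>. Thus \<open>n < 8 * q^2\<close>, the origin of the constant
    1/8.\<close>
  then obtain k where k: "4 ^ k \<le> n div 2" "n div 2 < 4 ^ (k + 1)"
    using ex_power_ivl1[of 4 "n div 2"] by auto
  define q :: nat where "q = 2 ^ k"
  have q2: "q\<^sup>2 = 4 ^ k" by (simp add: q_def power2_eq_square flip: power_mult_distrib)
  have n_lt: "n < 8 * q\<^sup>2" and n_ge: "2 * q\<^sup>2 \<le> n" using k q2 by auto
  \<comment> \<open>Here \<open>128 = 8 * 4^2\<close> enters. The resulting \<open>q > 4\<close>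
    makes the loss \<open>2 * q^2\<close> at most half of \<open>q^3\<close>.\<close>
  then have "4\<^sup>2 < q\<^sup>2" using n by simp
  then have q4: "4 < q" by (rule power_less_imp_less_base) simp
  then have "k > 0" by (cases k) (auto simp: q_def)
  then obtain I where I: "I \<subseteq> {0..<q\<^sup>2} \<times> {0..<q\<^sup>2}" "card I = q ^ 3"
    "\<And>a b c d. (a,b) \<in> I \<Longrightarrow> (c,b) \<in> I \<Longrightarrow> (a,d) \<in> I \<Longrightarrow> (c,d) \<in> I \<Longrightarrow> a = c \<or> b = d"
    using affine_plane_incidences[of k] unfolding q_def by blast
  have "card I \<le> b_C4 K n + 2 * q\<^sup>2"
    by (rule bipartite_b_C4_lower[OF n_ge _ _ I(1)]) (use n q4 I(3) in auto)
  then have "real (q ^ 3) \<le> real (b_C4 K n) + 2 * real (q\<^sup>2)"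
    unfolding I(2) by linarith
  moreover have "4 * real (q\<^sup>2) \<le> real (q ^ 3)"
    using q4 by (simp add: power2_eq_square power3_eq_cube)
  ultimately have b: "real q ^ 3 / 2 \<le> real (b_C4 K n)" by simp
  have "(1/8) powr (3/2) * real n powr (3/2) = (real n / 8) powr (3/2)"
    by (simp add: powr_mult[symmetric])
  also have "\<dots> < (real q ^ 2) powr (3/2)"
  proof (rule powr_less_mono2)
    have "real n < real (8 * q\<^sup>2)" using n_lt by (simp only: of_nat_less_iff)
    then show "real n / 8 < real q ^ 2" by simp
  qed auto
  also have "\<dots> = real q ^ 3"
  proof -
    have e: "real q powr 2 = real q ^ 2" "real q powr 3 = real q ^ 3" using q4 by simp_all
    have "(real q powr 2) powr (3/2) = real q powr (2 * (3/2))" by (rule powr_powr)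
    also have "2 * (3/2) = (3::real)" by simp
    finally show ?thesis unfolding e .
  qed
  finally show ?thesis using b by simp
qed

theorem theorem1p4:
  fixes K :: "'k::field itself"
  shows "\<exists>c C :: real. c > 0 \<and> C > 0 \<and> (\<forall>\<^sub>F n in sequentially.
           c * real n powr (3/2) < real (b_C4 K n) \<and>
           real (b_C4 K n) < real n powr (C * sqrt (ln (real n))))"
proof (intro exI conjI)
  \<comment> \<open>43 exceeds the 42 of the upper estimate, which makes the inequality
    strict.\<close>
  show "(1/8 :: real) powr (3/2) / 2 > 0" "(43::real) > 0" by simp_all
  show "\<forall>\<^sub>F n in sequentially. (1/8) powr (3/2) / 2 * real n powr (3/2) < real (b_C4 K n) \<and>
      real (b_C4 K n) < real n powr (43 * sqrt (ln (real n)))"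
    using eventually_ge_at_top[of 128]
  proof eventually_elim
    case (elim n)
    have "ln (real n) > 0" using elim by simp
    then have "exp (42 * sqrt (ln (real n)) * ln (real n)) < exp (43 * sqrt (ln (real n)) * ln (real n))"
      by simp
    also have "\<dots> = real n powr (43 * sqrt (ln (real n)))" using elim by (simp add: powr_def)
    finally show ?case using b_C4_lower[OF elim, of K] b_C4_upper[of n K] elim by simp
  qed
qed

end
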